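(* Let $\epsilon$ be a character for a shelf $(V,\Delta,\lhd)$ in a symmetric preadditive category $(\mathcal{C},\otimes,\mathbf{I},c)$. Put $V^n:=V^{\otimes n}$. Then the morphisms $$({^\epsilon} d)_{n;i}:=\big((\epsilon\otimes\lhd^{\otimes(i-1)})\circ\theta_{(i)}\circ(\Delta^{i-1})_i\big)\otimes\operatorname{Id}_V^{\otimes(n-i)}:V^n\to V^{n-1},$$ $$(d^\epsilon)_{n;i}:=\operatorname{Id}_V^{\otimes(i-1)}\otimes\epsilon\otimes\chi^{\otimes(n-i)}:V^n\to V^{n-1},\qquad 1\le i\le n,$$ define a pre-bisimplicial structure on $C_n:=V^n$, where $\chi=\epsilon_2\circ\Delta:V\to V$ and where $$\theta_{(i)}=\begin{pmatrix}1&2&\cdots&i-1&i&i+1&\cdots&2i-1\\2&4&\cdots&2(i-1)&1&3&\cdots&2i-1\end{pmatrix}\in S_{2i-1}$$ acts on $V^{2i-1}$ via the symmetric braiding $c$. Further, $(C_n,({^\epsilon} d)_{n;i},s_{n;i}:=\Delta_i)$ is a very weakly simplicial object, and it is weakly simplicial if $V$ is a spindle.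
   Context: All monoidal categories are strict; a symmetric category is a strict symmetric monoidal category. For $\varphi:V^{\otimes l}\to V^{\otimes r}$, $\varphi_i:=\operatorname{Id}_V^{\otimes(i-1)}\otimes\varphi\otimes\operatorname{Id}_V^{\otimes(k-i+1)}:V^{\otimes(k+l)}\to V^{\otimes(k+r)}$, and $\varphi^n:=\varphi_1\circ\cdots\circ\varphi_1$ ($n$ times); so $\Delta^{i-1}:V\to V^{i}$, and $(\Delta^{i-1})_i:V^i\to V^{2i-1}$ applies it to the $i$-th factor. $c$ means $c_{V,V}$. A permutation $\theta\in S_m$ acts on $V^m$ via $c$ by moving the factor in position $k$ to position $\theta(k)$. A shelf in $\mathcal{C}$ is an object $V$ with $\Delta:V\to V\otimes V$, $\lhd:V\otimes V\to V$ such that: (1) $\Delta_1\circ\Delta=\Delta_2\circ\Delta$ and $c_2\circ\Delta^3=\Delta^3:V\to V^4$; (2) $\lhd^2=\lhd\circ(\lhd\otimes\lhd)\circ c_2\circ\Delta_3:V^3\to V$; (3) $\Delta\circ\lhd=(\lhd\otimes\lhd)\circ c_2\circ(\Delta\otimes\Delta)$. A spindle is a shelf with $c_1\circ\Delta^2=\Delta^2$ and $\lhd\circ\Delta=\operatorname{Id}_V$. A character for a shelf is a morphism $\epsilon:V\to\mathbf{I}$ with $(\epsilon\otimes\epsilon)\circ\Delta=\epsilon$ and $\epsilon\circ\lhd=\epsilon\otimes\epsilon$. Consider objects $C_n$, $n\ge0$, with morphisms $d_i=d_{n;i},d'_i=d'_{n;i}:C_n\to C_{n-1}$ and $s_i=s_{n;i}:C_n\to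 C_{n+1}$, $1\le i\le n$ (below the source of all composites is $C_n$). - $(C_n,d_{n;i})$ is presimplicial if $d_id_j=d_{j-1}d_i$ for $1\le i<j\le n$. - $(C_n,d_{n;i},s_{n;i})$ is very weakly simplicial if it is presimplicial and $s_is_j=s_{j+1}s_i$ for $1\le i\le j\le n$; $d_is_j=s_{j-1}d_i$ for $1\le i<j\le n$; $d_is_j=s_jd_{i-1}$ for $1\le j$, $j+1<i\le n+1$. - It is weakly simplicial if moreover $d_is_i=d_{i+1}s_i$ for $1\le i\le n$. - $(C_n,d_{n;i},d'_{n;i})$ is pre-bisimplicial if both families $d$ and $d'$ are presimplicial and $d_id'_j=d'_{j-1}d_i$, $d'_id_j=d_{j-1}d'_i$ for $1\le i<j\le n$. *)

theory Defs
  imports "HOL-Algebra.Group" "HOL-Combinatorics.Transposition"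
begin

section \<open>Categories\<close>

record ('o, 'm) category =
  Obj :: "'o set"
  Arr :: "'m set"
  Dom :: "'m \<Rightarrow> 'o"
  Cod :: "'m \<Rightarrow> 'o"
  Id :: "'o \<Rightarrow> 'm" ("Id\<index>")
  Comp :: "'m \<Rightarrow> 'm \<Rightarrow> 'm" (infixr "\<cdot>\<index>" 60)

definition Hom :: "('o, 'm, 'z) category_scheme \<Rightarrow> 'o \<Rightarrow> 'o \<Rightarrow> 'm set" ("Hom\<index>") where
  "Hom\<^bsub>C\<^esub> A B = {f \<in> Arr C. Dom C f = A \<and> Cod C f = B}"

locale category =
  fixes C :: "('o, 'm, 'z) category_scheme" (structure)
  assumes Dom_in_Obj: "f \<in> Arr C \<Longrightarrow> Dom C f \<in> Obj C"
    and Cod_in_Obj: "f \<in> Arr C \<Longrightarrow> Cod C f \<in> Obj C"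
    and Id_in_Hom: "A \<in> Obj C \<Longrightarrow> Id A \<in> Hom A A"
    and Comp_in_Hom: "\<lbrakk>f \<in> Hom A B; g \<in> Hom B D\<rbrakk> \<Longrightarrow> g \<cdot> f \<in> Hom A D"
    and Comp_Id_right: "f \<in> Hom A B \<Longrightarrow> f \<cdot> Id A = f"
    and Comp_Id_left: "f \<in> Hom A B \<Longrightarrow> Id B \<cdot> f = f"
    and Comp_assoc:
      "\<lbrakk>f \<in> Hom A B; g \<in> Hom B D; h \<in> Hom D E\<rbrakk> \<Longrightarrow> (h \<cdot> g) \<cdot> f = h \<cdot> (g \<cdot> f)"

record ('o, 'm) monoidal_category = "('o, 'm) category" +
  TensO :: "'o \<Rightarrow> 'o \<Rightarrow> 'o" (infixr "\<otimes>\<^sub>o\<index>" 70)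
  TensM :: "'m \<Rightarrow> 'm \<Rightarrow> 'm" (infixr "\<otimes>\<^sub>m\<index>" 70)
  Unit :: 'o ("\<I>\<index>")

locale strict_monoidal_category = category C
  for C :: "('o, 'm, 'z) monoidal_category_scheme" (structure) +
  assumes Unit_in_Obj: "\<I> \<in> Obj C"
    and TensO_in_Obj: "\<lbrakk>A \<in> Obj C; B \<in> Obj C\<rbrakk> \<Longrightarrow> A \<otimes>\<^sub>o B \<in> Obj C"
    and TensM_in_Hom:
      "\<lbrakk>f \<in> Hom A B; g \<in> Hom A' B'\<rbrakk> \<Longrightarrow> f \<otimes>\<^sub>m g \<in> Hom (A \<otimes>\<^sub>o A') (B \<otimes>\<^sub>o B')"
    and TensM_Id: "\<lbrakk>A \<in> Obj C; B \<in> Obj C\<rbrakk> \<Longrightarrow> Id A \<otimes>\<^sub>m Id B = Id (A \<otimes>\<^sub>o B)"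
    and TensM_Comp:
      "\<lbrakk>f \<in> Hom A B; g \<in> Hom B D; f' \<in> Hom A' B'; g' \<in> Hom B' D'\<rbrakk>
        \<Longrightarrow> (g \<cdot> f) \<otimes>\<^sub>m (g' \<cdot> f') = (g \<otimes>\<^sub>m g') \<cdot> (f \<otimes>\<^sub>m f')"
    and TensO_assoc:
      "\<lbrakk>A \<in> Obj C; B \<in> Obj C; D \<in> Obj C\<rbrakk> \<Longrightarrow> (A \<otimes>\<^sub>o B) \<otimes>\<^sub>o D = A \<otimes>\<^sub>o (B \<otimes>\<^sub>o D)"
    and TensO_Unit_left: "A \<in> Obj C \<Longrightarrow> \<I> \<otimes>\<^sub>o A = A"
    and TensO_Unit_right: "A \<in> Obj C \<Longrightarrow> A \<otimes>\<^sub>o \<I> = A"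
    and TensM_assoc:
      "\<lbrakk>f \<in> Arr C; g \<in> Arr C; h \<in> Arr C\<rbrakk> \<Longrightarrow> (f \<otimes>\<^sub>m g) \<otimes>\<^sub>m h = f \<otimes>\<^sub>m (g \<otimes>\<^sub>m h)"
    and TensM_Unit_left: "f \<in> Arr C \<Longrightarrow> Id \<I> \<otimes>\<^sub>m f = f"
    and TensM_Unit_right: "f \<in> Arr C \<Longrightarrow> f \<otimes>\<^sub>m Id \<I> = f"

record ('o, 'm) symmetric_category = "('o, 'm) monoidal_category" +
  Braid :: "'o \<Rightarrow> 'o \<Rightarrow> 'm" ("\<c>\<index>")

locale symmetric_category = strict_monoidal_category C
  for C :: "('o, 'm, 'z) symmetric_category_scheme" (structure) +
  assumes Braid_in_Hom:
      "\<lbrakk>A \<in> Obj C; B \<in> Obj C\<rbrakk> \<Longrightarrow> \<c> A B \<in> Hom (A \<otimes>\<^sub>o B) (B \<otimes>\<^sub>o A)"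
    and Braid_natural:
      "\<lbrakk>f \<in> Hom A B; g \<in> Hom A' B'\<rbrakk> \<Longrightarrow> \<c> B B' \<cdot> (f \<otimes>\<^sub>m g) = (g \<otimes>\<^sub>m f) \<cdot> \<c> A A'"
    and Braid_TensO_right:
      "\<lbrakk>A \<in> Obj C; B \<in> Obj C; D \<in> Obj C\<rbrakk>
        \<Longrightarrow> \<c> A (B \<otimes>\<^sub>o D) = (Id B \<otimes>\<^sub>m \<c> A D) \<cdot> (\<c> A B \<otimes>\<^sub>m Id D)"
    and Braid_TensO_left:
      "\<lbrakk>A \<in> Obj C; B \<in> Obj C; D \<in> Obj C\<rbrakk>
        \<Longrightarrow> \<c> (A \<otimes>\<^sub>o B) D = (\<c> A D \<otimes>\<^sub>m Id B) \<cdot> (Id A \<otimes>\<^sub>m \<c> B D)"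
    and Braid_symmetric:
      "\<lbrakk>A \<in> Obj C; B \<in> Obj C\<rbrakk> \<Longrightarrow> \<c> B A \<cdot> \<c> A B = Id (A \<otimes>\<^sub>o B)"

record ('o, 'm) symmetric_preadditive_category = "('o, 'm) symmetric_category" +
  Add :: "'m \<Rightarrow> 'm \<Rightarrow> 'm"
  Zero :: "'o \<Rightarrow> 'o \<Rightarrow> 'm"

locale preadditive_category = category C
  for C :: "('o, 'm, 'z) symmetric_preadditive_category_scheme" (structure) +
  assumes Hom_comm_group:
      "\<lbrakk>A \<in> Obj C; B \<in> Obj C\<rbrakk>
        \<Longrightarrow> comm_group \<lparr>carrier = Hom A B, mult = Add C, one = Zero C A B\<rparr>"
    and Comp_Add_right:
      "\<lbrakk>f \<in> Hom A B; g \<in> Hom A B; h \<in> Hom B D\<rbrakk>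
        \<Longrightarrow> h \<cdot> Add C f g = Add C (h \<cdot> f) (h \<cdot> g)"
    and Comp_Add_left:
      "\<lbrakk>f \<in> Hom B D; g \<in> Hom B D; h \<in> Hom A B\<rbrakk>
        \<Longrightarrow> Add C f g \<cdot> h = Add C (f \<cdot> h) (g \<cdot> h)"

text \<open>
  Additivity of the tensor product in each argument is not required, so the definition covers
  both common readings of ``symmetric preadditive category''.
\<close>

locale symmetric_preadditive_category = symmetric_category C + preadditive_category C
  for C :: "('o, 'm, 'z) symmetric_preadditive_category_scheme" (structure)


section \<open>Simplicial structures\<close>

text \<open>
  In these notions \<open>d n i\<close> and \<open>s n i\<close> are only meaningful for \<open>1 \<le> i \<le> n\<close>: the numbering of
  faces and degeneracies starts at \<open>1\<close>, and there are none on \<open>X 0\<close>.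
\<close>

definition presimplicial ::
    "('o, 'm, 'z) category_scheme \<Rightarrow> (nat \<Rightarrow> 'o) \<Rightarrow> (nat \<Rightarrow> nat \<Rightarrow> 'm) \<Rightarrow> bool" where
  "presimplicial C X d \<longleftrightarrow>
    (\<forall>n. X n \<in> Obj C) \<and>
    (\<forall>n i. 1 \<le> i \<and> i \<le> n \<longrightarrow> d n i \<in> Hom\<^bsub>C\<^esub> (X n) (X (n - 1))) \<and>
    (\<forall>n i j. 1 \<le> i \<and> i < j \<and> j \<le> n \<longrightarrow>
      d (n - 1) i \<cdot>\<^bsub>C\<^esub> d n j = d (n - 1) (j - 1) \<cdot>\<^bsub>C\<^esub> d n i)"

definition very_weakly_simplicial ::
    "('o, 'm, 'z) category_scheme \<Rightarrow> (nat \<Rightarrow> 'o) \<Rightarrow> (nat \<Rightarrow> nat \<Rightarrow> 'm) \<Rightarrow> (nat \<Rightarrow> nat \<Rightarrow> 'm) \<Rightarrow> bool"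
  where
  "very_weakly_simplicial C X d s \<longleftrightarrow>
    presimplicial C X d \<and>
    (\<forall>n i. 1 \<le> i \<and> i \<le> n \<longrightarrow> s n i \<in> Hom\<^bsub>C\<^esub> (X n) (X (n + 1))) \<and>
    (\<forall>n i j. 1 \<le> i \<and> i \<le> j \<and> j \<le> n \<longrightarrow>
      s (n + 1) i \<cdot>\<^bsub>C\<^esub> s n j = s (n + 1) (j + 1) \<cdot>\<^bsub>C\<^esub> s n i) \<and>
    (\<forall>n i j. 1 \<le> i \<and> i < j \<and> j \<le> n \<longrightarrow>
      d (n + 1) i \<cdot>\<^bsub>C\<^esub> s n j = s (n - 1) (j - 1) \<cdot>\<^bsub>C\<^esub> d n i) \<and>
    (\<forall>n i j. 1 \<le> j \<and> j + 1 < i \<and> i \<le> n + 1 \<longrightarrow>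
      d (n + 1) i \<cdot>\<^bsub>C\<^esub> s n j = s (n - 1) j \<cdot>\<^bsub>C\<^esub> d n (i - 1))"

definition weakly_simplicial ::
    "('o, 'm, 'z) category_scheme \<Rightarrow> (nat \<Rightarrow> 'o) \<Rightarrow> (nat \<Rightarrow> nat \<Rightarrow> 'm) \<Rightarrow> (nat \<Rightarrow> nat \<Rightarrow> 'm) \<Rightarrow> bool"
  where
  "weakly_simplicial C X d s \<longleftrightarrow>
    very_weakly_simplicial C X d s \<and>
    (\<forall>n i. 1 \<le> i \<and> i \<le> n \<longrightarrow> d (n + 1) i \<cdot>\<^bsub>C\<^esub> s n i = d (n + 1) (i + 1) \<cdot>\<^bsub>C\<^esub> s n i)"

definition pre_bisimplicial ::
    "('o, 'm, 'z) category_scheme \<Rightarrow> (nat \<Rightarrow> 'o) \<Rightarrow> (nat \<Rightarrow> nat \<Rightarrow> 'm) \<Rightarrow> (nat \<Rightarrow> nat \<Rightarrow> 'm) \<Rightarrow> bool"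
  where
  "pre_bisimplicial C X d d' \<longleftrightarrow>
    presimplicial C X d \<and> presimplicial C X d' \<and>
    (\<forall>n i j. 1 \<le> i \<and> i < j \<and> j \<le> n \<longrightarrow>
      d (n - 1) i \<cdot>\<^bsub>C\<^esub> d' n j = d' (n - 1) (j - 1) \<cdot>\<^bsub>C\<^esub> d n i) \<and>
    (\<forall>n i j. 1 \<le> i \<and> i < j \<and> j \<le> n \<longrightarrow>
      d' (n - 1) i \<cdot>\<^bsub>C\<^esub> d n j = d (n - 1) (j - 1) \<cdot>\<^bsub>C\<^esub> d' n i)"


section \<open>Tensor powers and permutations of factors\<close>

primrec obj_pow :: "('o, 'm, 'z) monoidal_category_scheme \<Rightarrow> 'o \<Rightarrow> nat \<Rightarrow> 'o" where
  "obj_pow C V 0 = \<I>\<^bsub>C\<^esub>"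
| "obj_pow C V (Suc n) = V \<otimes>\<^sub>o\<^bsub>C\<^esub> obj_pow C V n"

primrec mor_pow :: "('o, 'm, 'z) monoidal_category_scheme \<Rightarrow> 'm \<Rightarrow> nat \<Rightarrow> 'm" where
  "mor_pow C f 0 = Id\<^bsub>C\<^esub> \<I>\<^bsub>C\<^esub>"
| "mor_pow C f (Suc n) = f \<otimes>\<^sub>m\<^bsub>C\<^esub> mor_pow C f n"

text \<open>
  \<open>at_pos C V k \<phi> i\<close> is \<open>\<phi>\<^sub>i : V\<^bsup>k+l\<^esup> \<rightarrow> V\<^bsup>k+r\<^esup>\<close> for \<open>\<phi> : V\<^bsup>l\<^esup> \<rightarrow> V\<^bsup>r\<^esup>\<close> and \<open>1 \<le> i \<le> k + 1\<close>.  The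
  number \<open>k\<close> of strands not touched by \<open>\<phi>\<close> has to be given, as it is not determined by \<open>\<phi>\<close> and \<open>i\<close>.
\<close>

definition at_pos :: "('o, 'm, 'z) monoidal_category_scheme \<Rightarrow> 'o \<Rightarrow> nat \<Rightarrow> 'm \<Rightarrow> nat \<Rightarrow> 'm" where
  "at_pos C V k \<phi> i =
    mor_pow C (Id\<^bsub>C\<^esub> V) (i - 1) \<otimes>\<^sub>m\<^bsub>C\<^esub> \<phi> \<otimes>\<^sub>m\<^bsub>C\<^esub> mor_pow C (Id\<^bsub>C\<^esub> V) (k + 1 - i)"

text \<open>\<open>comult_pow C V \<Delta> n = \<Delta>\<^sub>1 \<circ> \<dots> \<circ> \<Delta>\<^sub>1 : V \<rightarrow> V\<^bsup>n+1\<^esup>\<close> with \<open>n\<close> factors.\<close>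

primrec comult_pow :: "('o, 'm, 'z) monoidal_category_scheme \<Rightarrow> 'o \<Rightarrow> 'm \<Rightarrow> nat \<Rightarrow> 'm" where
  "comult_pow C V \<Delta> 0 = Id\<^bsub>C\<^esub> V"
| "comult_pow C V \<Delta> (Suc n) = at_pos C V n \<Delta> 1 \<cdot>\<^bsub>C\<^esub> comult_pow C V \<Delta> n"

text \<open>
  A word \<open>[i\<^sub>1, \<dots>, i\<^sub>p]\<close> in \<open>{1..<m}\<close> stands for the permutation \<open>s\<^bsub>i\<^sub>1\<^esub> \<circ> \<dots> \<circ> s\<^bsub>i\<^sub>p\<^esub>\<close>, where \<open>s\<^sub>i\<close>
  exchanges \<open>i\<close> and \<open>i + 1\<close>, and for the morphism \<open>c\<^bsub>i\<^sub>1\<^esub> \<circ> \<dots> \<circ> c\<^bsub>i\<^sub>p\<^esub>\<close> of \<open>V\<^bsup>m\<^esup>\<close>, which moves the factor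
  in position \<open>k\<close> to the position that is the value of this permutation at \<open>k\<close>.
\<close>

primrec word_perm :: "nat list \<Rightarrow> nat \<Rightarrow> nat" where
  "word_perm [] = id"
| "word_perm (i # w) = transpose i (i + 1) \<circ> word_perm w"

primrec word_mor ::
    "('o, 'm, 'z) symmetric_category_scheme \<Rightarrow> 'o \<Rightarrow> nat \<Rightarrow> nat list \<Rightarrow> 'm" where
  "word_mor C V m [] = Id\<^bsub>C\<^esub> (obj_pow C V m)"
| "word_mor C V m (i # w) = at_pos C V (m - 2) (\<c>\<^bsub>C\<^esub> V V) i \<cdot>\<^bsub>C\<^esub> word_mor C V m w"

text \<open>
  The action of a permutation \<open>\<theta>\<close> of \<open>{1..m}\<close> (fixing all other numbers) on \<open>V\<^bsup>m\<^esup>\<close>.  Since \<open>c\<close> is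
  symmetric, the \<open>c\<^sub>i\<close> satisfy the Coxeter relations of the symmetric group, so that the
  morphism described here exists and is unique.
\<close>

definition perm_action ::
    "('o, 'm, 'z) symmetric_category_scheme \<Rightarrow> 'o \<Rightarrow> nat \<Rightarrow> (nat \<Rightarrow> nat) \<Rightarrow> 'm" where
  "perm_action C V m \<theta> =
    (THE f. \<exists>w. set w \<subseteq> {1..<m} \<and> word_perm w = \<theta> \<and> f = word_mor C V m w)"


section \<open>Shelves, spindles and characters\<close>

text \<open>The operation of the shelf, written as a left-pointing triangle on paper, is called \<open>tri\<close>.\<close>

definition shelf :: "('o, 'm, 'z) symmetric_category_scheme \<Rightarrow> 'o \<Rightarrow> 'm \<Rightarrow> 'm \<Rightarrow> bool" where
  "shelf C V \<Delta> tri \<longleftrightarrow>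
    V \<in> Obj C \<and> \<Delta> \<in> Hom\<^bsub>C\<^esub> V (V \<otimes>\<^sub>o\<^bsub>C\<^esub> V) \<and> tri \<in> Hom\<^bsub>C\<^esub> (V \<otimes>\<^sub>o\<^bsub>C\<^esub> V) V \<and>
    at_pos C V 1 \<Delta> 1 \<cdot>\<^bsub>C\<^esub> \<Delta> = at_pos C V 1 \<Delta> 2 \<cdot>\<^bsub>C\<^esub> \<Delta> \<and>
    at_pos C V 2 (\<c>\<^bsub>C\<^esub> V V) 2 \<cdot>\<^bsub>C\<^esub> comult_pow C V \<Delta> 3 = comult_pow C V \<Delta> 3 \<and>
    tri \<cdot>\<^bsub>C\<^esub> at_pos C V 1 tri 1 =
      tri \<cdot>\<^bsub>C\<^esub> (tri \<otimes>\<^sub>m\<^bsub>C\<^esub> tri) \<cdot>\<^bsub>C\<^esub> at_pos C V 2 (\<c>\<^bsub>C\<^esub> V V) 2 \<cdot>\<^bsub>C\<^esub> at_pos C V 2 \<Delta> 3 \<and>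
    \<Delta> \<cdot>\<^bsub>C\<^esub> tri =
      (tri \<otimes>\<^sub>m\<^bsub>C\<^esub> tri) \<cdot>\<^bsub>C\<^esub> at_pos C V 2 (\<c>\<^bsub>C\<^esub> V V) 2 \<cdot>\<^bsub>C\<^esub> (\<Delta> \<otimes>\<^sub>m\<^bsub>C\<^esub> \<Delta>)"

definition spindle :: "('o, 'm, 'z) symmetric_category_scheme \<Rightarrow> 'o \<Rightarrow> 'm \<Rightarrow> 'm \<Rightarrow> bool" where
  "spindle C V \<Delta> tri \<longleftrightarrow>
    shelf C V \<Delta> tri \<and>
    at_pos C V 1 (\<c>\<^bsub>C\<^esub> V V) 1 \<cdot>\<^bsub>C\<^esub> comult_pow C V \<Delta> 2 = comult_pow C V \<Delta> 2 \<and>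
    tri \<cdot>\<^bsub>C\<^esub> \<Delta> = Id\<^bsub>C\<^esub> V"

definition shelf_character ::
    "('o, 'm, 'z) symmetric_category_scheme \<Rightarrow> 'o \<Rightarrow> 'm \<Rightarrow> 'm \<Rightarrow> 'm \<Rightarrow> bool" where
  "shelf_character C V \<Delta> tri \<epsilon> \<longleftrightarrow>
    \<epsilon> \<in> Hom\<^bsub>C\<^esub> V \<I>\<^bsub>C\<^esub> \<and>
    (\<epsilon> \<otimes>\<^sub>m\<^bsub>C\<^esub> \<epsilon>) \<cdot>\<^bsub>C\<^esub> \<Delta> = \<epsilon> \<and>
    \<epsilon> \<cdot>\<^bsub>C\<^esub> tri = \<epsilon> \<otimes>\<^sub>m\<^bsub>C\<^esub> \<epsilon>"

definition theta :: "nat \<Rightarrow> nat \<Rightarrow> nat" where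
  "theta i k =
    (if 1 \<le> k \<and> k < i then 2 * k
     else if i \<le> k \<and> k \<le> 2 * i - 1 then 2 * (k - i) + 1
     else k)"

definition left_face ::
    "('o, 'm, 'z) symmetric_category_scheme \<Rightarrow> 'o \<Rightarrow> 'm \<Rightarrow> 'm \<Rightarrow> 'm \<Rightarrow> nat \<Rightarrow> nat \<Rightarrow> 'm" where
  "left_face C V \<Delta> tri \<epsilon> n i =
    ((\<epsilon> \<otimes>\<^sub>m\<^bsub>C\<^esub> mor_pow C tri (i - 1)) \<cdot>\<^bsub>C\<^esub>
      perm_action C V (2 * i - 1) (theta i) \<cdot>\<^bsub>C\<^esub>
      at_pos C V (i - 1) (comult_pow C V \<Delta> (i - 1)) i)
    \<otimes>\<^sub>m\<^bsub>C\<^esub> mor_pow C (Id\<^bsub>C\<^esub> V) (n - i)"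

definition chi :: "('o, 'm, 'z) monoidal_category_scheme \<Rightarrow> 'o \<Rightarrow> 'm \<Rightarrow> 'm \<Rightarrow> 'm" where
  "chi C V \<Delta> \<epsilon> = at_pos C V 1 \<epsilon> 2 \<cdot>\<^bsub>C\<^esub> \<Delta>"

definition right_face ::
    "('o, 'm, 'z) monoidal_category_scheme \<Rightarrow> 'o \<Rightarrow> 'm \<Rightarrow> 'm \<Rightarrow> nat \<Rightarrow> nat \<Rightarrow> 'm" where
  "right_face C V \<Delta> \<epsilon> n i =
    mor_pow C (Id\<^bsub>C\<^esub> V) (i - 1) \<otimes>\<^sub>m\<^bsub>C\<^esub> \<epsilon> \<otimes>\<^sub>m\<^bsub>C\<^esub> mor_pow C (chi C V \<Delta> \<epsilon>) (n - i)"

definition degeneracy ::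
    "('o, 'm, 'z) monoidal_category_scheme \<Rightarrow> 'o \<Rightarrow> 'm \<Rightarrow> nat \<Rightarrow> nat \<Rightarrow> 'm" where
  "degeneracy C V \<Delta> n i = at_pos C V (n - 1) \<Delta> i"

end

theory Submission
  imports Defs
begin

text \<open>
  Write \<open>A m : V\<^sup>m \<otimes> V \<rightarrow> V\<^sup>m\<close> for the diagonal right action of \<open>V\<close> on \<open>V\<^sup>m\<close>, starting from
  \<open>A 0 = \<epsilon>\<close>; the left faces are \<open>A (i - 1) \<otimes> Id\<close>.  All identities involving a left face follow from
  one principle: if \<open>f\<close> intertwines two actions up to an endomorphism \<open>g\<close> of the shelf \<open>V\<close>, then
  \<open>f \<otimes> g\<^sup>b\<close> intertwines the diagonal actions on the tensor products with \<open>V\<^sup>b\<close>.  It is applied to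
  \<open>A a\<close> itself and to \<open>\<Delta>\<close> (with \<open>g = Id\<close>), and to \<open>\<epsilon>\<close> (with \<open>g = \<chi>\<close>).  That \<open>A a\<close> intertwines,
  i.e. that \<open>A a\<close> is self-distributive, is preserved by \<open>- \<otimes> V\<close>, because the diagonal action is a
  composite of the equivariant maps \<open>Id \<otimes> \<Delta>\<close>, \<open>Id \<otimes> c \<otimes> Id\<close> and \<open>\<rho> \<otimes> \<lhd>\<close>; the second is
  equivariant by the weak cocommutativity \<open>c\<^sub>2 \<circ> \<Delta>\<^sup>3 = \<Delta>\<^sup>3\<close>.
\<close>

section \<open>String calculus\<close>

lemma in_Hom_iff: "f \<in> Hom\<^bsub>C\<^esub> A B \<longleftrightarrow> f \<in> Arr C \<and> Dom C f = A \<and> Cod C f = B"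
  by (simp add: Hom_def)

section \<open>Composition in a category\<close>

context category
begin

lemma Obj_Dom_Cod [simp]: "f \<in> Arr C \<Longrightarrow> Dom C f \<in> Obj C" "f \<in> Arr C \<Longrightarrow> Cod C f \<in> Obj C"
  by (rule Dom_in_Obj Cod_in_Obj, assumption)+

lemma Id_simps [simp]:
  assumes "A \<in> Obj C"
  shows "Id A \<in> Arr C" "Dom C (Id A) = A" "Cod C (Id A) = A"
  using Id_in_Hom[OF assms] by (simp_all add: in_Hom_iff)

lemma Comp_simps [simp]:
  assumes "f \<in> Arr C" "g \<in> Arr C" "Cod C f = Dom C g"
  shows "g \<cdot> f \<in> Arr C" "Dom C (g \<cdot> f) = Dom C f" "Cod C (g \<cdot> f) = Cod C g"
  using Comp_in_Hom[of f "Dom C f" "Dom C g" g "Cod C g"] assms by (simp_all add: in_Hom_iff)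

lemma Comp_Id [simp]:
  assumes "f \<in> Arr C"
  shows "Dom C f = A \<Longrightarrow> f \<cdot> Id A = f" "Cod C f = A \<Longrightarrow> Id A \<cdot> f = f"
  using assms Comp_Id_right Comp_Id_left by (auto simp: in_Hom_iff)

lemma Comp_assoc' [simp]:
  assumes "f \<in> Arr C" "g \<in> Arr C" "h \<in> Arr C" "Cod C f = Dom C g" "Cod C g = Dom C h"
  shows "(h \<cdot> g) \<cdot> f = h \<cdot> g \<cdot> f"
  using Comp_assoc[of f _ "Dom C g" g "Dom C h" h] assms by (simp add: in_Hom_iff)

text \<open>Composites are kept nested to the right, so an equation for \<open>g \<cdot> h\<close>
  no longer matches once a tail \<open>f\<close> follows; this is the version with a tail.\<close>

lemma Comp_rewrite:
  assumes "g \<cdot> h = k" "f \<in> Arr C" "g \<in> Arr C" "h \<in> Arr C" "Cod C f = Dom C h" "Cod C h = Dom C g"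
  shows "g \<cdot> h \<cdot> f = k \<cdot> f"
  using assms by (metis Comp_assoc')

end

section \<open>Tensor products, interchange and tensor powers\<close>

context strict_monoidal_category
begin

declare Unit_in_Obj [simp] TensO_in_Obj [simp] TensO_assoc [simp] TensO_Unit_left [simp]
  TensO_Unit_right [simp] TensM_assoc [simp] TensM_Unit_left [simp] TensM_Unit_right [simp]

lemma Id_TensO [simp]: "A \<in> Obj C \<Longrightarrow> B \<in> Obj C \<Longrightarrow> Id (A \<otimes>\<^sub>o B) = Id A \<otimes>\<^sub>m Id B"
  by (simp add: TensM_Id)

lemma TensM_simps [simp]:
  assumes "f \<in> Arr C" "g \<in> Arr C"
  shows "f \<otimes>\<^sub>m g \<in> Arr C" "Dom C (f \<otimes>\<^sub>m g) = Dom C f \<otimes>\<^sub>o Dom C g"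
    "Cod C (f \<otimes>\<^sub>m g) = Cod C f \<otimes>\<^sub>o Cod C g"
  using TensM_in_Hom[of f "Dom C f" "Cod C f" g "Dom C g" "Cod C g"] assms
  by (simp_all add: in_Hom_iff)

text \<open>\<open>Id_TensO\<close> turns the identity of a tensor product into a tensor product of
  identities, to which \<open>Comp_Id\<close> does not apply. The premise recognises such a product
  as an identity.\<close>

lemma Comp_TensM_Id [simp]:
  assumes "f \<in> Arr C"
  shows "Id (Dom C f) = Id A \<otimes>\<^sub>m g \<Longrightarrow> f \<cdot> (Id A \<otimes>\<^sub>m g) = f"
    "Id (Cod C f) = Id A \<otimes>\<^sub>m g \<Longrightarrow> (Id A \<otimes>\<^sub>m g) \<cdot> f = f"
  using Comp_Id[OF assms] by metis+

lemma interchange: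
  assumes "f \<in> Arr C" "g \<in> Arr C" "f' \<in> Arr C" "g' \<in> Arr C"
    "Cod C f = Dom C g" "Cod C f' = Dom C g'"
  shows "(g \<otimes>\<^sub>m g') \<cdot> (f \<otimes>\<^sub>m f') = (g \<cdot> f) \<otimes>\<^sub>m (g' \<cdot> f')"
  using TensM_Comp[of f _ "Dom C g" g _ f' _ "Dom C g'" g'] assms by (simp add: in_Hom_iff)

lemma interchange_Comp:
  assumes "f \<in> Arr C" "g \<in> Arr C" "f' \<in> Arr C" "g' \<in> Arr C" "h \<in> Arr C"
    "Cod C f = Dom C g" "Cod C f' = Dom C g'" "Cod C h = Dom C f \<otimes>\<^sub>o Dom C f'"
  shows "(g \<otimes>\<^sub>m g') \<cdot> (f \<otimes>\<^sub>m f') \<cdot> h = ((g \<cdot> f) \<otimes>\<^sub>m (g' \<cdot> f')) \<cdot> h"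
  using interchange[of f g f' g'] assms by (subst Comp_assoc'[symmetric]) simp_all

text \<open>The reverse of \<open>interchange\<close>: a composite inside one tensor factor is
  pulled apart, and the other factor \<open>h\<close> stays with the later map.\<close>

lemma TensM_Comp_left:
  assumes "f \<in> Arr C" "g \<in> Arr C" "h \<in> Arr C" "Cod C f = Dom C g"
  shows "(g \<cdot> f) \<otimes>\<^sub>m h = (g \<otimes>\<^sub>m h) \<cdot> (f \<otimes>\<^sub>m Id (Dom C h))"
  using assms by (simp add: interchange)

lemma TensM_Comp_right:
  assumes "f \<in> Arr C" "g \<in> Arr C" "h \<in> Arr C" "Cod C f = Dom C g"
  shows "h \<otimes>\<^sub>m (g \<cdot> f) = (h \<otimes>\<^sub>m g) \<cdot> (Id (Dom C h) \<otimes>\<^sub>m f)"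
  using assms by (simp add: interchange)

lemmas expand = TensM_Comp_left TensM_Comp_right

lemma slide:
  assumes "f \<in> Arr C" "g \<in> Arr C" "Cod C f = A" "Dom C g = B"
  shows "(Id A \<otimes>\<^sub>m g) \<cdot> (f \<otimes>\<^sub>m Id B) = f \<otimes>\<^sub>m g"
  using assms by (auto simp: interchange)

text \<open>The intermediate objects of the two sides may differ, so a face identity can be checked
  separately on blocks of tensor factors.\<close>

lemma TensM_Comp_cong:
  assumes "f \<cdot> g = h \<cdot> k" "p \<cdot> q = s \<cdot> t"
    and "f \<in> Arr C" "g \<in> Arr C" "h \<in> Arr C" "k \<in> Arr C" "p \<in> Arr C" "q \<in> Arr C" "s \<in> Arr C" "t \<in> Arr C"
    and "Cod C g = Dom C f" "Cod C k = Dom C h" "Cod C q = Dom C p" "Cod C t = Dom C s"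
  shows "(f \<otimes>\<^sub>m p) \<cdot> (g \<otimes>\<^sub>m q) = (h \<otimes>\<^sub>m s) \<cdot> (k \<otimes>\<^sub>m t)"
  using assms by (simp add: interchange)

lemma obj_pow_in_Obj [simp]: "V \<in> Obj C \<Longrightarrow> obj_pow C V n \<in> Obj C"
  by (induction n) simp_all

lemma obj_pow_add: "V \<in> Obj C \<Longrightarrow> obj_pow C V (a + b) = obj_pow C V a \<otimes>\<^sub>o obj_pow C V b"
  by (induction a) simp_all

lemma obj_pow_Suc_right: "V \<in> Obj C \<Longrightarrow> obj_pow C V (Suc n) = obj_pow C V n \<otimes>\<^sub>o V"
  using obj_pow_add[of V n 1] by simp

lemma mor_pow_simps [simp]:
  assumes "f \<in> Arr C"
  shows "mor_pow C f n \<in> Arr C" "Dom C (mor_pow C f n) = obj_pow C (Dom C f) n"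
    "Cod C (mor_pow C f n) = obj_pow C (Cod C f) n"
  using assms by (induction n) simp_all

lemma mor_pow_Id [simp]: "V \<in> Obj C \<Longrightarrow> mor_pow C (Id V) n = Id (obj_pow C V n)"
  by (induction n) simp_all

lemma mor_pow_add: "f \<in> Arr C \<Longrightarrow> mor_pow C f (a + b) = mor_pow C f a \<otimes>\<^sub>m mor_pow C f b"
  by (induction a) simp_all

lemma mor_pow_Suc_right: "f \<in> Arr C \<Longrightarrow> mor_pow C f (Suc n) = mor_pow C f n \<otimes>\<^sub>m f"
  using mor_pow_add[of f n 1] by simp

lemma at_pos_eq:
  assumes "V \<in> Obj C" "k = a + b" "i = Suc a"
  shows "at_pos C V k f i = Id (obj_pow C V a) \<otimes>\<^sub>m f \<otimes>\<^sub>m Id (obj_pow C V b)"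
  using assms by (simp add: at_pos_def)

end

section \<open>The symmetry, and products of actions twisted by it\<close>

context symmetric_category
begin

lemma Braid_simps [simp]:
  assumes "A \<in> Obj C" "B \<in> Obj C"
  shows "\<c> A B \<in> Arr C" "Dom C (\<c> A B) = A \<otimes>\<^sub>o B" "Cod C (\<c> A B) = B \<otimes>\<^sub>o A"
  using Braid_in_Hom[OF assms] by (simp_all add: in_Hom_iff)

lemma Braid_nat:
  assumes "f \<in> Arr C" "g \<in> Arr C" "Cod C f = B" "Cod C g = B'"
  shows "\<c> B B' \<cdot> (f \<otimes>\<^sub>m g) = (g \<otimes>\<^sub>m f) \<cdot> \<c> (Dom C f) (Dom C g)"
  using Braid_natural[of f "Dom C f" B g "Dom C g" B'] assms by (simp add: in_Hom_iff)

text \<open>The hexagon with two unit objects makes \<open>\<c> A \<I>\<close> idempotent, and by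
  symmetry it is invertible.\<close>

lemma Braid_Unit_right [simp]:
  assumes A: "A \<in> Obj C" shows "\<c> A \<I> = Id A"
proof -
  have e: "\<c> A \<I> = \<c> A \<I> \<cdot> \<c> A \<I>"
    using Braid_TensO_right[of A \<I> \<I>] A by simp
  have "\<c> \<I> A \<cdot> \<c> A \<I> \<cdot> \<c> A \<I> = \<c> A \<I>"
    by (subst Comp_rewrite[OF Braid_symmetric]) (simp_all add: A)
  then show ?thesis
    using e Braid_symmetric[of A \<I>] A by simp
qed

lemma Braid_Unit_left [simp]:
  assumes A: "A \<in> Obj C" shows "\<c> \<I> A = Id A"
  using Braid_symmetric[of A \<I>] A by simp

text \<open>
  In Sweedler notation \<open>\<delta> p = p' \<otimes> p''\<close>, this is \<open>x \<otimes> y \<otimes> p \<mapsto> \<rho> (x \<otimes> p') \<otimes> \<sigma> (y \<otimes> p'')\<close>, for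
  \<open>\<rho> : X \<otimes> Q \<rightarrow> X'\<close>, \<open>\<sigma> : Y \<otimes> R \<rightarrow> Y'\<close> and \<open>\<delta> : P \<rightarrow> Q \<otimes> R\<close>.
\<close>

definition conv :: "'o \<Rightarrow> 'o \<Rightarrow> 'o \<Rightarrow> 'o \<Rightarrow> 'm \<Rightarrow> 'm \<Rightarrow> 'm \<Rightarrow> 'm" where
  "conv X Y Q R \<delta> \<rho> \<sigma> = (\<rho> \<otimes>\<^sub>m \<sigma>) \<cdot> (Id X \<otimes>\<^sub>m \<c> Y Q \<otimes>\<^sub>m Id R) \<cdot> (Id (X \<otimes>\<^sub>o Y) \<otimes>\<^sub>m \<delta>)"

lemma conv_simps [simp]:
  assumes "X \<in> Obj C" "Y \<in> Obj C" "Q \<in> Obj C" "R \<in> Obj C"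
    "\<rho> \<in> Arr C" "Dom C \<rho> = X \<otimes>\<^sub>o Q" "\<sigma> \<in> Arr C" "Dom C \<sigma> = Y \<otimes>\<^sub>o R"
    "\<delta> \<in> Arr C" "Cod C \<delta> = Q \<otimes>\<^sub>o R"
  shows "conv X Y Q R \<delta> \<rho> \<sigma> \<in> Arr C"
    "Dom C (conv X Y Q R \<delta> \<rho> \<sigma>) = X \<otimes>\<^sub>o Y \<otimes>\<^sub>o Dom C \<delta>"
    "Cod C (conv X Y Q R \<delta> \<rho> \<sigma>) = Cod C \<rho> \<otimes>\<^sub>o Cod C \<sigma>"
  using assms by (simp_all add: conv_def)

lemma conv_comp:
  assumes "X \<in> Obj C" "Y \<in> Obj C" "Q \<in> Obj C" "R \<in> Obj C"
    "\<rho> \<in> Arr C" "Dom C \<rho> = X \<otimes>\<^sub>o Q" "\<sigma> \<in> Arr C" "Dom C \<sigma> = Y \<otimes>\<^sub>o R"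
    "\<delta> \<in> Arr C" "Cod C \<delta> = Q \<otimes>\<^sub>o R"
    "f \<in> Arr C" "Dom C f = Cod C \<rho>" "g \<in> Arr C" "Dom C g = Cod C \<sigma>"
  shows "(f \<otimes>\<^sub>m g) \<cdot> conv X Y Q R \<delta> \<rho> \<sigma> = conv X Y Q R \<delta> (f \<cdot> \<rho>) (g \<cdot> \<sigma>)"
  using assms by (simp add: conv_def interchange_Comp)

text \<open>Only \<open>g\<close> and \<open>h\<close> lie on strands that cross. Naturality of the
  braiding carries them through, after which \<open>h\<close> and \<open>k\<close> merge with
  \<open>\<delta>\<close>.\<close>

lemma conv_natural:
  assumes "Q \<in> Obj C" "R \<in> Obj C"
    "f \<in> Arr C" "Dom C f = X" "Cod C f = X'" "g \<in> Arr C" "Dom C g = Y" "Cod C g = Y'"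
    "h \<in> Arr C" "Dom C h = Q" "Cod C h = Q'" "k \<in> Arr C" "Dom C k = R" "Cod C k = R'"
    "\<rho> \<in> Arr C" "Dom C \<rho> = X' \<otimes>\<^sub>o Q'" "\<sigma> \<in> Arr C" "Dom C \<sigma> = Y' \<otimes>\<^sub>o R'"
    "\<delta> \<in> Arr C" "Cod C \<delta> = Q \<otimes>\<^sub>o R" "Dom C \<delta> = P"
  shows "conv X Y Q R \<delta> (\<rho> \<cdot> (f \<otimes>\<^sub>m h)) (\<sigma> \<cdot> (g \<otimes>\<^sub>m k)) =
    conv X' Y' Q' R' ((h \<otimes>\<^sub>m k) \<cdot> \<delta>) \<rho> \<sigma> \<cdot> (f \<otimes>\<^sub>m g \<otimes>\<^sub>m Id P)"
proof -
  have [simp]: "X \<in> Obj C" "Y \<in> Obj C" "X' \<in> Obj C" "Y' \<in> Obj C" "Q' \<in> Obj C" "R' \<in> Obj C"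
    "P \<in> Obj C"
    using assms Obj_Dom_Cod by blast+
  note [simp] = assms
  have "(\<rho> \<cdot> (f \<otimes>\<^sub>m h)) \<otimes>\<^sub>m (\<sigma> \<cdot> (g \<otimes>\<^sub>m k)) = (\<rho> \<otimes>\<^sub>m \<sigma>) \<cdot> (f \<otimes>\<^sub>m (h \<otimes>\<^sub>m g) \<otimes>\<^sub>m k)"
    using interchange[of "f \<otimes>\<^sub>m h" \<rho> "g \<otimes>\<^sub>m k" \<sigma>] by simp
  moreover have "(f \<otimes>\<^sub>m (h \<otimes>\<^sub>m g) \<otimes>\<^sub>m k) \<cdot> (Id X \<otimes>\<^sub>m \<c> Y Q \<otimes>\<^sub>m Id R)
      = f \<otimes>\<^sub>m ((h \<otimes>\<^sub>m g) \<cdot> \<c> Y Q) \<otimes>\<^sub>m k"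
    by (simp add: interchange del: TensM_assoc)
  moreover have "\<dots> = f \<otimes>\<^sub>m (\<c> Y' Q' \<cdot> (g \<otimes>\<^sub>m h)) \<otimes>\<^sub>m k"
    using Braid_nat[of g h Y' Q'] by simp
  moreover have "\<dots> = (Id X' \<otimes>\<^sub>m \<c> Y' Q' \<otimes>\<^sub>m Id R') \<cdot> (f \<otimes>\<^sub>m (g \<otimes>\<^sub>m h) \<otimes>\<^sub>m k)"
    by (simp add: interchange del: TensM_assoc)
  ultimately have 1: "((\<rho> \<cdot> (f \<otimes>\<^sub>m h)) \<otimes>\<^sub>m (\<sigma> \<cdot> (g \<otimes>\<^sub>m k))) \<cdot> (Id X \<otimes>\<^sub>m \<c> Y Q \<otimes>\<^sub>m Id R) =
     (\<rho> \<otimes>\<^sub>m \<sigma>) \<cdot> (Id X' \<otimes>\<^sub>m \<c> Y' Q' \<otimes>\<^sub>m Id R') \<cdot> (f \<otimes>\<^sub>m g \<otimes>\<^sub>m h \<otimes>\<^sub>m k)"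
    by simp
  have 2: "(f \<otimes>\<^sub>m g \<otimes>\<^sub>m h \<otimes>\<^sub>m k) \<cdot> (Id (X \<otimes>\<^sub>o Y) \<otimes>\<^sub>m \<delta>) =
    (Id (X' \<otimes>\<^sub>o Y') \<otimes>\<^sub>m ((h \<otimes>\<^sub>m k) \<cdot> \<delta>)) \<cdot> (f \<otimes>\<^sub>m g \<otimes>\<^sub>m Id P)"
    by (simp add: interchange)
  show ?thesis unfolding conv_def
    using 1 2 by (simp add: Comp_rewrite[OF 1])
qed

text \<open>Both sides consist of the crossing of \<open>Z\<close> with \<open>Q\<close>, followed
  by those of \<open>Y\<close> with \<open>Q\<close> and of \<open>Z\<close> with \<open>R\<close>;
  the last two take place on disjoint strands.\<close>

lemma shuffle_hexagon:
  assumes [simp]: "Y \<in> Obj C" "Z \<in> Obj C" "Q \<in> Obj C" "R \<in> Obj C"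
  shows "(\<c> Y Q \<otimes>\<^sub>m Id R \<otimes>\<^sub>m Id Z) \<cdot> (Id Y \<otimes>\<^sub>m \<c> Z (Q \<otimes>\<^sub>o R)) =
    (Id Q \<otimes>\<^sub>m Id Y \<otimes>\<^sub>m \<c> Z R) \<cdot> (\<c> (Y \<otimes>\<^sub>o Z) Q \<otimes>\<^sub>m Id R)"
proof -
  have "(\<c> Y Q \<otimes>\<^sub>m Id R \<otimes>\<^sub>m Id Z) \<cdot> (Id Y \<otimes>\<^sub>m \<c> Z (Q \<otimes>\<^sub>o R)) =
     (\<c> Y Q \<otimes>\<^sub>m Id (R \<otimes>\<^sub>o Z)) \<cdot> (Id (Y \<otimes>\<^sub>o Q) \<otimes>\<^sub>m \<c> Z R) \<cdot> (Id Y \<otimes>\<^sub>m \<c> Z Q \<otimes>\<^sub>m Id R)"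
    by (simp add: Braid_TensO_right interchange)
  also have "\<dots> = (Id (Q \<otimes>\<^sub>o Y) \<otimes>\<^sub>m \<c> Z R) \<cdot> (\<c> Y Q \<otimes>\<^sub>m Id (Z \<otimes>\<^sub>o R)) \<cdot> (Id Y \<otimes>\<^sub>m \<c> Z Q \<otimes>\<^sub>m Id R)"
    by (simp add: interchange_Comp del: Id_TensO TensM_assoc)
  also have "(\<c> Y Q \<otimes>\<^sub>m Id (Z \<otimes>\<^sub>o R)) \<cdot> (Id Y \<otimes>\<^sub>m \<c> Z Q \<otimes>\<^sub>m Id R) =  \<c> (Y \<otimes>\<^sub>o Z) Q \<otimes>\<^sub>m Id R"
    using interchange[of "Id Y \<otimes>\<^sub>m \<c> Z Q" "\<c> Y Q \<otimes>\<^sub>m Id Z" "Id R" "Id R"] 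
    by (simp add: Braid_TensO_left)
  finally show ?thesis by simp
qed

text \<open>Both sides are \<open>\<rho> (x \<otimes> p') \<otimes> \<sigma> (y \<otimes> p'')
  \<otimes> \<tau> (z \<otimes> p''')\<close>; \<open>eq\<close> says that the two ways of splitting
  \<open>p\<close> into three agree.\<close>

lemma conv_assoc:
  assumes [simp]: "X \<in> Obj C" "Y \<in> Obj C" "Z \<in> Obj C" "Q \<in> Obj C" "R \<in> Obj C" "S \<in> Obj C"
    "\<rho> \<in> Arr C" "Dom C \<rho> = X \<otimes>\<^sub>o Q" "\<sigma> \<in> Arr C" "Dom C \<sigma> = Y \<otimes>\<^sub>o R"
    "\<tau> \<in> Arr C" "Dom C \<tau> = Z \<otimes>\<^sub>o S"
    "\<delta> \<in> Arr C" "Dom C \<delta> = P1" "Cod C \<delta> = Q \<otimes>\<^sub>o R"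
    "\<delta>' \<in> Arr C" "Dom C \<delta>' = P" "Cod C \<delta>' = P1 \<otimes>\<^sub>o S"
    "\<gamma> \<in> Arr C" "Dom C \<gamma> = P2" "Cod C \<gamma> = R \<otimes>\<^sub>o S"
    "\<gamma>' \<in> Arr C" "Dom C \<gamma>' = P" "Cod C \<gamma>' = Q \<otimes>\<^sub>o P2"
    and eq: "(\<delta> \<otimes>\<^sub>m Id S) \<cdot> \<delta>' = (Id Q \<otimes>\<^sub>m \<gamma>) \<cdot> \<gamma>'"
  shows "conv (X \<otimes>\<^sub>o Y) Z P1 S \<delta>' (conv X Y Q R \<delta> \<rho> \<sigma>) \<tau> =
    conv X (Y \<otimes>\<^sub>o Z) Q P2 \<gamma>' \<rho> (conv Y Z R S \<gamma> \<sigma> \<tau>)"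
proof -
  have [simp]: "P \<in> Obj C" "P1 \<in> Obj C" "P2 \<in> Obj C"
    using assms Obj_Dom_Cod by blast+
  let ?M = "Id X \<otimes>\<^sub>m ((\<c> Y Q \<otimes>\<^sub>m Id R \<otimes>\<^sub>m Id Z) \<cdot> (Id Y \<otimes>\<^sub>m \<c> Z (Q \<otimes>\<^sub>o R))) \<otimes>\<^sub>m Id S"
  have "conv (X \<otimes>\<^sub>o Y) Z P1 S \<delta>' (conv X Y Q R \<delta> \<rho> \<sigma>) \<tau> =
     (\<rho> \<otimes>\<^sub>m \<sigma> \<otimes>\<^sub>m \<tau>) \<cdot> (Id X \<otimes>\<^sub>m (\<c> Y Q \<otimes>\<^sub>m Id R \<otimes>\<^sub>m Id Z) \<otimes>\<^sub>m Id S) \<cdot>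
     (Id (X \<otimes>\<^sub>o Y) \<otimes>\<^sub>m ((\<delta> \<otimes>\<^sub>m Id Z) \<cdot> \<c> Z P1) \<otimes>\<^sub>m Id S) \<cdot> (Id (X \<otimes>\<^sub>o Y \<otimes>\<^sub>o Z) \<otimes>\<^sub>m \<delta>')"
    by (simp add: conv_def expand)
  \<comment> \<open>Pulling \<open>\<delta>\<close> back through the braiding puts it next to
    \<open>\<delta>'\<close>, so that \<open>eq\<close> applies.\<close>
  also have "(\<delta> \<otimes>\<^sub>m Id Z) \<cdot> \<c> Z P1 = \<c> Z (Q \<otimes>\<^sub>o R) \<cdot> (Id Z \<otimes>\<^sub>m \<delta>)"
    using Braid_nat[of "Id Z" \<delta> Z "Q \<otimes>\<^sub>o R"] by simp
  also have "(\<rho> \<otimes>\<^sub>m \<sigma> \<otimes>\<^sub>m \<tau>) \<cdot> (Id X \<otimes>\<^sub>m (\<c> Y Q \<otimes>\<^sub>m Id R \<otimes>\<^sub>m Id Z) \<otimes>\<^sub>m Id S) \<cdot>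
     (Id (X \<otimes>\<^sub>o Y) \<otimes>\<^sub>m (\<c> Z (Q \<otimes>\<^sub>o R) \<cdot> (Id Z \<otimes>\<^sub>m \<delta>)) \<otimes>\<^sub>m Id S) \<cdot> (Id (X \<otimes>\<^sub>o Y \<otimes>\<^sub>o Z) \<otimes>\<^sub>m \<delta>')
     = (\<rho> \<otimes>\<^sub>m \<sigma> \<otimes>\<^sub>m \<tau>) \<cdot> ?M \<cdot> (Id (X \<otimes>\<^sub>o Y \<otimes>\<^sub>o Z) \<otimes>\<^sub>m ((\<delta> \<otimes>\<^sub>m Id S) \<cdot> \<delta>'))"
    by (simp add: expand)
  also have "\<dots> = (\<rho> \<otimes>\<^sub>m \<sigma> \<otimes>\<^sub>m \<tau>) \<cdot>
      (Id X \<otimes>\<^sub>m ((Id Q \<otimes>\<^sub>m Id Y \<otimes>\<^sub>m \<c> Z R) \<cdot> (\<c> (Y \<otimes>\<^sub>o Z) Q \<otimes>\<^sub>m Id R)) \<otimes>\<^sub>m Id S) \<cdot>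
      (Id (X \<otimes>\<^sub>o Y \<otimes>\<^sub>o Z) \<otimes>\<^sub>m ((Id Q \<otimes>\<^sub>m \<gamma>) \<cdot> \<gamma>'))"
    by (simp only: eq shuffle_hexagon assms)
  also have "\<dots> = conv X (Y \<otimes>\<^sub>o Z) Q P2 \<gamma>' \<rho> (conv Y Z R S \<gamma> \<sigma> \<tau>)"
  proof -
    \<comment> \<open>\<open>\<gamma>\<close> and the braiding act on disjoint strands.\<close>
    have "(Id (X \<otimes>\<^sub>o Q \<otimes>\<^sub>o Y \<otimes>\<^sub>o Z) \<otimes>\<^sub>m \<gamma>) \<cdot> (Id X \<otimes>\<^sub>m \<c> (Y \<otimes>\<^sub>o Z) Q \<otimes>\<^sub>m Id P2)
      = (Id X \<otimes>\<^sub>m \<c> (Y \<otimes>\<^sub>o Z) Q \<otimes>\<^sub>m Id (R \<otimes>\<^sub>o S)) \<cdot> (Id (X \<otimes>\<^sub>o Y \<otimes>\<^sub>o Z \<otimes>\<^sub>o Q) \<otimes>\<^sub>m \<gamma>)" (is ?e)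
      using interchange[of "\<c> (Y \<otimes>\<^sub>o Z) Q" "Id (Q \<otimes>\<^sub>o Y \<otimes>\<^sub>o Z)" "Id P2" \<gamma>]
        interchange[of "Id (Y \<otimes>\<^sub>o Z \<otimes>\<^sub>o Q)" "\<c> (Y \<otimes>\<^sub>o Z) Q" \<gamma> "Id (R \<otimes>\<^sub>o S)"]
      by (simp add: interchange)
    then have e: ?e .
    show ?thesis
      using Comp_rewrite[OF e, of "Id (X \<otimes>\<^sub>o Y \<otimes>\<^sub>o Z) \<otimes>\<^sub>m \<gamma>'"] by (simp add: conv_def expand)
  qed
  finally show ?thesis .
qed

text \<open>Of the four crossings that make up the large braiding, that of \<open>Q\<close> with
  \<open>Y\<close> comes first and cancels \<open>\<c> Y Q\<close> by symmetry.\<close>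

lemma Braid_interleave:
  assumes [simp]: "X \<in> Obj C" "Y \<in> Obj C" "Q \<in> Obj C" "R \<in> Obj C"
  shows "\<c> (X \<otimes>\<^sub>o Q) (Y \<otimes>\<^sub>o R) \<cdot> (Id X \<otimes>\<^sub>m \<c> Y Q \<otimes>\<^sub>m Id R) =
    (Id Y \<otimes>\<^sub>m \<c> X R \<otimes>\<^sub>m Id Q) \<cdot> (\<c> X Y \<otimes>\<^sub>m \<c> Q R)"
proof -
  have "\<c> (X \<otimes>\<^sub>o Q) (Y \<otimes>\<^sub>o R) = (Id Y \<otimes>\<^sub>m \<c> (X \<otimes>\<^sub>o Q) R) \<cdot> (\<c> (X \<otimes>\<^sub>o Q) Y \<otimes>\<^sub>m Id R)"
    by (simp add: Braid_TensO_right)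
  also have "\<dots> = (Id Y \<otimes>\<^sub>m \<c> X R \<otimes>\<^sub>m Id Q) \<cdot> (Id (Y \<otimes>\<^sub>o X) \<otimes>\<^sub>m \<c> Q R) \<cdot>
     (\<c> X Y \<otimes>\<^sub>m Id (Q \<otimes>\<^sub>o R)) \<cdot> (Id X \<otimes>\<^sub>m \<c> Q Y \<otimes>\<^sub>m Id R)"
    by (simp add: Braid_TensO_left expand)
  also have "(Id (Y \<otimes>\<^sub>o X) \<otimes>\<^sub>m \<c> Q R) \<cdot> (\<c> X Y \<otimes>\<^sub>m Id (Q \<otimes>\<^sub>o R)) \<cdot> (Id X \<otimes>\<^sub>m \<c> Q Y \<otimes>\<^sub>m Id R)
    = (\<c> X Y \<otimes>\<^sub>m \<c> Q R) \<cdot> (Id X \<otimes>\<^sub>m \<c> Q Y \<otimes>\<^sub>m Id R)"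
    by (simp add: interchange_Comp del: Id_TensO TensM_assoc)
  finally have 1: "\<c> (X \<otimes>\<^sub>o Q) (Y \<otimes>\<^sub>o R) = (Id Y \<otimes>\<^sub>m \<c> X R \<otimes>\<^sub>m Id Q) \<cdot>
      (\<c> X Y \<otimes>\<^sub>m \<c> Q R) \<cdot> (Id X \<otimes>\<^sub>m \<c> Q Y \<otimes>\<^sub>m Id R)" .
  show ?thesis
    by (simp add: 1 interchange Braid_symmetric)
qed

text \<open>Naturality moves the swap of the outputs ahead of \<open>\<rho>\<close> and
  \<open>\<sigma>\<close>. \<open>Braid_interleave\<close> resolves it into a swap of
  \<open>X\<close> and \<open>Y\<close> and a swap of the legs of \<open>\<delta>\<close>, where
  cocommutativity can be applied.\<close>

lemma Braid_conv:
  assumes [simp]: "X \<in> Obj C" "Y \<in> Obj C" "Q \<in> Obj C" "R \<in> Obj C"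
    "\<rho> \<in> Arr C" "Dom C \<rho> = X \<otimes>\<^sub>o Q" "\<sigma> \<in> Arr C" "Dom C \<sigma> = Y \<otimes>\<^sub>o R"
    "\<delta> \<in> Arr C" "Cod C \<delta> = Q \<otimes>\<^sub>o R" "Dom C \<delta> = P"
    "Cod C \<rho> = X'" "Cod C \<sigma> = Y'"
  shows "\<c> X' Y' \<cdot> conv X Y Q R \<delta> \<rho> \<sigma> = conv Y X R Q (\<c> Q R \<cdot> \<delta>) \<sigma> \<rho> \<cdot> (\<c> X Y \<otimes>\<^sub>m Id P)"
proof -
  have [simp]: "P \<in> Obj C" "X' \<in> Obj C" "Y' \<in> Obj C"
    using assms Obj_Dom_Cod by blast+
  have "\<c> X' Y' \<cdot> (\<rho> \<otimes>\<^sub>m \<sigma>) = (\<sigma> \<otimes>\<^sub>m \<rho>) \<cdot> \<c> (X \<otimes>\<^sub>o Q) (Y \<otimes>\<^sub>o R)"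
    using Braid_nat[of \<rho> \<sigma> X' Y'] by simp
  then have "\<c> X' Y' \<cdot> conv X Y Q R \<delta> \<rho> \<sigma> =
    (\<sigma> \<otimes>\<^sub>m \<rho>) \<cdot> (\<c> (X \<otimes>\<^sub>o Q) (Y \<otimes>\<^sub>o R) \<cdot> (Id X \<otimes>\<^sub>m \<c> Y Q \<otimes>\<^sub>m Id R)) \<cdot> (Id (X \<otimes>\<^sub>o Y) \<otimes>\<^sub>m \<delta>)"
    using Comp_rewrite[of "\<c> X' Y'" "\<rho> \<otimes>\<^sub>m \<sigma>"] by (simp add: conv_def)
  also have "\<dots> = (\<sigma> \<otimes>\<^sub>m \<rho>) \<cdot> (Id Y \<otimes>\<^sub>m \<c> X R \<otimes>\<^sub>m Id Q) \<cdot> (\<c> X Y \<otimes>\<^sub>m \<c> Q R) \<cdot> (Id (X \<otimes>\<^sub>o Y) \<otimes>\<^sub>m \<delta>)"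
    by (simp add: Braid_interleave)
  also have "(\<c> X Y \<otimes>\<^sub>m \<c> Q R) \<cdot> (Id (X \<otimes>\<^sub>o Y) \<otimes>\<^sub>m \<delta>) = (Id (Y \<otimes>\<^sub>o X) \<otimes>\<^sub>m (\<c> Q R \<cdot> \<delta>)) \<cdot> (\<c> X Y \<otimes>\<^sub>m Id P)"
    by (simp add: interchange del: Id_TensO)
  finally show ?thesis by (simp add: conv_def)
qed

lemma conv_precomp:
  assumes "X \<in> Obj C" "Y \<in> Obj C" "Q \<in> Obj C" "R \<in> Obj C"
    "\<rho> \<in> Arr C" "Dom C \<rho> = X \<otimes>\<^sub>o Q" "\<sigma> \<in> Arr C" "Dom C \<sigma> = Y \<otimes>\<^sub>o R"
    "\<delta> \<in> Arr C" "Cod C \<delta> = Q \<otimes>\<^sub>o R" "p \<in> Arr C" "Cod C p = Dom C \<delta>"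
  shows "conv X Y Q R (\<delta> \<cdot> p) \<rho> \<sigma> = conv X Y Q R \<delta> \<rho> \<sigma> \<cdot> (Id X \<otimes>\<^sub>m Id Y \<otimes>\<^sub>m p)"
  using assms by (simp add: conv_def interchange)

lemma conv_left:
  assumes "Y \<in> Obj C" "Q \<in> Obj C" "R \<in> Obj C"
    "f \<in> Arr C" "Dom C f = X" "Cod C f = X'"
    "\<rho> \<in> Arr C" "Dom C \<rho> = X' \<otimes>\<^sub>o Q" "\<sigma> \<in> Arr C" "Dom C \<sigma> = Y \<otimes>\<^sub>o R"
    "\<delta> \<in> Arr C" "Cod C \<delta> = Q \<otimes>\<^sub>o R" "Dom C \<delta> = P"
  shows "conv X Y Q R \<delta> (\<rho> \<cdot> (f \<otimes>\<^sub>m Id Q)) \<sigma> = conv X' Y Q R \<delta> \<rho> \<sigma> \<cdot> (f \<otimes>\<^sub>m Id Y \<otimes>\<^sub>m Id P)"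
  using conv_natural[of Q R f X X' "Id Y" Y Y "Id Q" Q "Id R" R \<rho> \<sigma> \<delta> P] assms by simp

lemma conv_right:
  assumes "X \<in> Obj C" "Q \<in> Obj C" "R \<in> Obj C"
    "g \<in> Arr C" "Dom C g = Y" "Cod C g = Y'"
    "\<rho> \<in> Arr C" "Dom C \<rho> = X \<otimes>\<^sub>o Q" "\<sigma> \<in> Arr C" "Dom C \<sigma> = Y' \<otimes>\<^sub>o R"
    "\<delta> \<in> Arr C" "Cod C \<delta> = Q \<otimes>\<^sub>o R" "Dom C \<delta> = P"
  shows "conv X Y Q R \<delta> \<rho> (\<sigma> \<cdot> (g \<otimes>\<^sub>m Id R)) = conv X Y' Q R \<delta> \<rho> \<sigma> \<cdot> (Id X \<otimes>\<^sub>m g \<otimes>\<^sub>m Id P)"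
  using conv_natural[of Q R "Id X" X X g Y Y' "Id Q" Q "Id R" R \<rho> \<sigma> \<delta> P] assms by simp

end

section \<open>Words in the generators, the Coxeter relations and their normal forms\<close>

section \<open>Permutations of tensor factors\<close>

text \<open>This congruence mediates between permutations and morphisms: words in range with equal
  permutations are related, and related words in range give equal morphisms, so
  \<open>perm_action\<close> is well defined.\<close>

inductive coxeter_eq :: "nat \<Rightarrow> nat list \<Rightarrow> nat list \<Rightarrow> bool" for m where
  coxeter_refl: "coxeter_eq m w w"
| coxeter_sym: "coxeter_eq m v w \<Longrightarrow> coxeter_eq m w v"
| coxeter_trans: "coxeter_eq m u v \<Longrightarrow> coxeter_eq m v w \<Longrightarrow> coxeter_eq m u w"
| coxeter_append: "coxeter_eq m v w \<Longrightarrow> coxeter_eq m v' w' \<Longrightarrow> coxeter_eq m (v @ v') (w @ w')"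
| coxeter_square: "1 \<le> i \<Longrightarrow> i < m \<Longrightarrow> coxeter_eq m [i, i] []"
| coxeter_commute: "1 \<le> i \<Longrightarrow> Suc i < j \<Longrightarrow> j < m \<Longrightarrow> coxeter_eq m [i, j] [j, i]"
| coxeter_braid: "1 \<le> i \<Longrightarrow> Suc i < m \<Longrightarrow> coxeter_eq m [i, Suc i, i] [Suc i, i, Suc i]"

declare coxeter_trans [trans]

lemma coxeter_eq_mono:
  assumes "coxeter_eq m v w" "m \<le> m'"
  shows "coxeter_eq m' v w"
  using assms by induction (auto intro: coxeter_eq.intros)

lemma word_perm_append: "word_perm (v @ w) = word_perm v \<circ> word_perm w"
  by (induction v) (simp_all add: comp_assoc)

lemma coxeter_eq_word_perm:
  assumes "coxeter_eq m v w"
  shows "word_perm v = word_perm w"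
  using assms
  by induction (auto simp: word_perm_append fun_eq_iff transpose_def)

lemma coxeter_eq_commute_word:
  assumes "1 \<le> i" "i < m" "set w \<subseteq> {1..<m}" "\<And>j. j \<in> set w \<Longrightarrow> i + 1 < j \<or> j + 1 < i"
  shows "coxeter_eq m (w @ [i]) (i # w)"
  using assms(3,4)
proof (induction w)
  case Nil
  show ?case by (simp add: coxeter_refl)
next
  case (Cons j w)
  have 1: "coxeter_eq m ([j] @ (w @ [i])) ([j] @ (i # w))"
    using Cons by (intro coxeter_append coxeter_refl) auto
  have "i + 1 < j \<or> j + 1 < i" "1 \<le> j" "j < m"
    using Cons.prems by auto
  then have "coxeter_eq m [j, i] [i, j]"
    using assms(1,2) coxeter_commute[of i j m] coxeter_commute[of j i m] coxeter_sym by auto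
  then have "coxeter_eq m ([j, i] @ w) ([i, j] @ w)"
    by (intro coxeter_append coxeter_refl)
  with 1 show ?case
    by (auto intro: coxeter_trans)
qed

text \<open>The rightmost letter acts first, so this word carries \<open>k\<close> up to
  \<open>m\<close>. For \<open>1 \<le> k \<le> m\<close> these words represent the right cosets of
  the permutations of \<open>m - 1\<close> points in those of \<open>m\<close> points.\<close>

definition descend :: "nat \<Rightarrow> nat \<Rightarrow> nat list" where
  "descend m k = rev [k..<m]"

lemma set_descend [simp]: "set (descend m k) = {k..<m}"
  by (simp add: descend_def)

lemma descend_self [simp]: "descend m m = []"
  by (simp add: descend_def)

lemma descend_snoc: "k < m \<Longrightarrow> descend m k = descend m (Suc k) @ [k]"
  by (simp add: descend_def upt_conv_Cons)

lemma descend_split: "k \<le> l \<Longrightarrow> l \<le> m \<Longrightarrow> descend m k = descend m l @ descend l k"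
  unfolding descend_def by (metis le_Suc_ex rev_append upt_add_eq_append)

lemma word_perm_descend:
  assumes "k \<le> m"
  shows "word_perm (descend m k) j = (if j = k then m else if k < j \<and> j \<le> m then j - 1 else j)"
  using assms
proof (induction k arbitrary: j rule: inc_induct)
  case base
  show ?case by simp
next
  case (step k)
  then show ?case by (auto simp: descend_snoc word_perm_append transpose_def)
qed

text \<open>A generator permutes the cosets: a letter below \<open>k - 1\<close> commutes to the
  left, \<open>k - 1\<close> lengthens the word, \<open>k\<close> shortens it, and a letter above
  \<open>k\<close> crosses it with its index lowered by one.\<close>

lemma descend_append_generator:
  assumes "1 \<le> k" "k \<le> m" "1 \<le> i" "i < m"
  shows "\<exists>u l. set u \<subseteq> {1..<m - 1} \<and> 1 \<le> l \<and> l \<le> m \<and>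
    coxeter_eq m (descend m k @ [i]) (u @ descend m l)"
proof -
  consider "i + 1 < k" | "i + 1 = k" | "i = k" | "k < i" by linarith
  then show ?thesis
  proof cases
    case 1
    then have "coxeter_eq m (descend m k @ [i]) ([i] @ descend m k)"
      using assms coxeter_eq_commute_word[of i m "descend m k"] by auto
    moreover have "set [i] \<subseteq> {1..<m - 1}"
      using 1 assms by auto
    ultimately show ?thesis using assms by blast
  next
    case 2
    then have "descend m k @ [i] = [] @ descend m i"
      using assms descend_snoc[of i m] by simp
    then show ?thesis using assms coxeter_refl
      by (metis empty_set empty_subsetI le_eq_less_or_eq)
  next
    case 3
    have "coxeter_eq m (descend m (Suc k) @ [k, i]) (descend m (Suc k) @ [])"
      using 3 assms by (intro coxeter_append coxeter_refl) (simp add: coxeter_square)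
    then have "coxeter_eq m (descend m k @ [i]) ([] @ descend m (Suc k))"
      using 3 assms by (simp add: descend_snoc)
    moreover have "set [] \<subseteq> {1..<m - 1}" by simp
    ultimately show ?thesis using 3 assms by (metis Suc_leI le_SucI)
  next
    case 4
    \<comment> \<open>The word contains \<open>i, j\<close> consecutively, and what follows commutes
      with \<open>i\<close>. The braid relation turns \<open>i, j, i\<close> into
      \<open>j, i, j\<close>, whose first letter commutes with everything before it.\<close>
    define j where "j = i - 1"
    have j: "i = Suc j" "k \<le> j" "1 \<le> j" using 4 assms by (auto simp: j_def)
    have split: "descend m k = descend m (Suc i) @ [i, j] @ descend j k"
      using j assms descend_split[of k j m] descend_snoc[of j m] descend_snoc[of i m] by simp
    have "coxeter_eq m (descend j k @ [i]) (i # descend j k)"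
      using j assms by (intro coxeter_eq_commute_word) auto
    then have "coxeter_eq m ((descend m (Suc i) @ [i, j]) @ (descend j k @ [i]))
        ((descend m (Suc i) @ [i, j]) @ (i # descend j k))"
      by (intro coxeter_append coxeter_refl)
    then have "coxeter_eq m (descend m k @ [i]) (descend m (Suc i) @ [i, j, i] @ descend j k)"
      by (simp add: split)
    also have "coxeter_eq m [i, j, i] [j, i, j]"
      using coxeter_sym[OF coxeter_braid[of j m]] j assms by simp
    then have "coxeter_eq m (descend m (Suc i) @ [i, j, i] @ descend j k)
       (descend m (Suc i) @ [j, i, j] @ descend j k)"
      by (intro coxeter_append coxeter_refl)
    also have "coxeter_eq m (descend m (Suc i) @ [j]) (j # descend m (Suc i))"
      using j assms by (intro coxeter_eq_commute_word) auto
    then have "coxeter_eq m ((descend m (Suc i) @ [j]) @ ([i, j] @ descend j k))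
        ((j # descend m (Suc i)) @ ([i, j] @ descend j k))"
      by (intro coxeter_append coxeter_refl)
    then have "coxeter_eq m (descend m (Suc i) @ [j, i, j] @ descend j k) ([j] @ descend m k)"
      by (simp add: split)
    finally have "coxeter_eq m (descend m k @ [i]) ([j] @ descend m k)" .
    moreover have "set [j] \<subseteq> {1..<m - 1}"
      using j assms by auto
    ultimately show ?thesis using assms by blast
  qed
qed

text \<open>Letters are absorbed one at a time by \<open>descend_append_generator\<close>, what they
  leave behind joining \<open>u\<close>.\<close>

lemma coxeter_normal_form:
  assumes "set w \<subseteq> {1..<m}" "1 \<le> m"
  shows "\<exists>u k. set u \<subseteq> {1..<m - 1} \<and> 1 \<le> k \<and> k \<le> m \<and> coxeter_eq m w (u @ descend m k)"
  using assms(1)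
proof (induction w rule: rev_induct)
  case Nil
  have "coxeter_eq m [] ([] @ descend m m)" by (simp add: coxeter_refl)
  moreover have "set [] \<subseteq> {1..<m - 1}" by simp
  ultimately show ?case using assms(2) by blast
next
  case (snoc i w)
  then obtain u k where u: "set u \<subseteq> {1..<m - 1}" "1 \<le> k" "k \<le> m" "coxeter_eq m w (u @ descend m k)"
    by auto
  with descend_append_generator[of k m i] snoc.prems
  obtain v l where v: "set v \<subseteq> {1..<m - 1}" "1 \<le> l" "l \<le> m"
    "coxeter_eq m (descend m k @ [i]) (v @ descend m l)" by auto
  have "coxeter_eq m (w @ [i]) ((u @ descend m k) @ [i])"
    using u(4) coxeter_refl by (rule coxeter_append)
  moreover have "coxeter_eq m (u @ (descend m k @ [i])) (u @ (v @ descend m l))"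
    using coxeter_refl v(4) by (rule coxeter_append)
  ultimately have "coxeter_eq m (w @ [i]) ((u @ v) @ descend m l)"
    using coxeter_trans by simp
  moreover have "set (u @ v) \<subseteq> {1..<m - 1}" using u v by simp
  ultimately show ?case using v by blast
qed

lemma word_perm_fixes: "set w \<subseteq> {1..<m} \<Longrightarrow> m < j \<Longrightarrow> word_perm w j = j"
  by (induction w) (auto simp: transpose_def)

lemma bij_word_perm: "bij (word_perm w)"
  by (induction w) (simp_all only: word_perm.simps bij_id bij_comp bij_transpose)

text \<open>
  In the normal form \<open>u @ descend m k\<close> the number \<open>k\<close> is the preimage of \<open>m\<close>, so equal permutations
  have the same \<open>k\<close>, and the remaining words \<open>u\<close> are compared by induction.
\<close>

lemma word_perm_eq_imp_coxeter_eq: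
  assumes "set v \<subseteq> {1..<m}" "set w \<subseteq> {1..<m}" "word_perm v = word_perm w"
  shows "coxeter_eq m v w"
  using assms
proof (induction m arbitrary: v w)
  case 0
  then show ?case by (simp add: coxeter_refl)
next
  case (Suc m)
  let ?M = "Suc m"
  from coxeter_normal_form[of v ?M] Suc.prems(1) obtain v' k where v':
    "set v' \<subseteq> {1..<m}" "1 \<le> k" "k \<le> ?M" "coxeter_eq ?M v (v' @ descend ?M k)" by auto
  from coxeter_normal_form[of w ?M] Suc.prems(2) obtain w' l where w':
    "set w' \<subseteq> {1..<m}" "1 \<le> l" "l \<le> ?M" "coxeter_eq ?M w (w' @ descend ?M l)" by auto
  have eq: "word_perm v' \<circ> word_perm (descend ?M k) = word_perm w' \<circ> word_perm (descend ?M l)"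
    using coxeter_eq_word_perm[OF v'(4)] coxeter_eq_word_perm[OF w'(4)] Suc.prems(3)
    by (metis word_perm_append)
  have "(word_perm v' \<circ> word_perm (descend ?M k)) k = ?M"
    "(word_perm w' \<circ> word_perm (descend ?M l)) l = ?M"
    using word_perm_fixes[OF v'(1), of ?M] word_perm_fixes[OF w'(1), of ?M] v' w'
    by (simp_all add: word_perm_descend)
  moreover have "inj (word_perm w' \<circ> word_perm (descend ?M l))"
    using bij_word_perm by (metis bij_betw_def bij_comp)
  ultimately have "k = l"
    using eq by (metis injD)
  then have "word_perm v' = word_perm w'"
    using eq bij_word_perm[of "descend ?M l"] by (metis bij_is_surj surj_fun_eq)
  then have "coxeter_eq m v' w'"
    using Suc.IH v' w' by blast
  then have "coxeter_eq ?M (v' @ descend ?M k) (w' @ descend ?M l)"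
    using \<open>k = l\<close> by (intro coxeter_append) (auto intro: coxeter_eq_mono coxeter_refl)
  then show ?case
    using v'(4) w'(4) by (meson coxeter_sym coxeter_trans)
qed

text \<open>
  Passing from \<open>m\<close> to \<open>m + 1\<close> strands: the new strand, in position \<open>m + 1\<close>, first moves past the
  \<open>m + 1\<close> copies that act on \<open>\<epsilon>\<close> and on the previous strands.
\<close>

primrec theta_word :: "nat \<Rightarrow> nat list" where
  "theta_word 0 = []"
| "theta_word (Suc m) = theta_word m @ descend (2 * m + 2) (m + 1)"

lemma set_theta_word: "set (theta_word m) \<subseteq> {1..<2 * m + 1}"
  by (induction m) auto

lemma word_perm_theta_word: "word_perm (theta_word m) = theta (m + 1)"
proof (induction m)
  case 0
  show ?case by (auto simp: theta_def)
next
  case (Suc m)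
  show ?case
    by (rule ext) (auto simp: word_perm_append Suc word_perm_descend theta_def)
qed

section \<open>The morphisms of tensor powers given by words\<close>

locale symmetric_category_with_object = symmetric_category C
  for C :: "('o, 'm, 'z) symmetric_category_scheme" (structure) +
  fixes V :: 'o
  assumes V [simp]: "V \<in> Obj C"
begin

abbreviation pow :: "nat \<Rightarrow> 'o" where "pow n \<equiv> obj_pow C V n"

text \<open>Writing \<open>m\<close> as \<open>a + 2 + b\<close> exhibits the strands on either side
  of the crossing and removes the truncated subtraction.\<close>

lemma generator_eq:
  assumes "m = a + 2 + b" "i = Suc a"
  shows "at_pos C V (m - 2) (\<c> V V) i = Id (pow a) \<otimes>\<^sub>m \<c> V V \<otimes>\<^sub>m Id (pow b)"
  using assms by (intro at_pos_eq) simp_all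

lemma generator_simps [simp]:
  assumes "1 \<le> i" "i < m"
  shows "at_pos C V (m - 2) (\<c> V V) i \<in> Arr C"
    "Dom C (at_pos C V (m - 2) (\<c> V V) i) = pow m"
    "Cod C (at_pos C V (m - 2) (\<c> V V) i) = pow m"
proof -
  obtain a where i: "i = Suc a" using assms(1) by (cases i) auto
  obtain b where m: "m = a + 2 + b" using assms(2) i less_iff_Suc_add by fastforce
  show "at_pos C V (m - 2) (\<c> V V) i \<in> Arr C"
    "Dom C (at_pos C V (m - 2) (\<c> V V) i) = pow m"
    "Cod C (at_pos C V (m - 2) (\<c> V V) i) = pow m"
    by (simp_all add: generator_eq[OF m i]) (simp_all add: m obj_pow_add numeral_2_eq_2 
        del: add_Suc_right add_2_eq_Suc add_2_eq_Suc')
qed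

lemma word_mor_simps [simp]:
  assumes "set w \<subseteq> {1..<m}"
  shows "word_mor C V m w \<in> Arr C" "Dom C (word_mor C V m w) = pow m"
    "Cod C (word_mor C V m w) = pow m"
  using assms by (induction w) simp_all

lemma word_mor_append:
  assumes "set v \<subseteq> {1..<m}" "set w \<subseteq> {1..<m}"
  shows "word_mor C V m (v @ w) = word_mor C V m v \<cdot> word_mor C V m w"
  using assms by (induction v) simp_all

lemma word_mor_square:
  assumes "1 \<le> i" "i < m"
  shows "word_mor C V m [i, i] = word_mor C V m []"
proof -
  obtain a where i: "i = Suc a" using assms(1) by (cases i) auto
  obtain b where m: "m = a + 2 + b" using assms(2) i less_iff_Suc_add by fastforce
  have "pow m = pow a \<otimes>\<^sub>o V \<otimes>\<^sub>o V \<otimes>\<^sub>o pow b"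
    using m obj_pow_add[of V a "Suc (Suc b)"] by simp
  then show ?thesis
    by (simp add: generator_eq[OF m i] interchange Braid_symmetric)
qed

lemma word_mor_commute:
  assumes "1 \<le> i" "Suc i < j" "j < m"
  shows "word_mor C V m [i, j] = word_mor C V m [j, i]"
proof -
  obtain a where i: "i = Suc a" using assms(1) by (cases i) auto
  obtain b where j: "j = Suc (a + Suc (Suc b))" using assms(2) i less_iff_Suc_add by fastforce
  obtain e where m: "m = a + Suc (Suc b) + 2 + e" using assms(3) j less_iff_Suc_add by fastforce
  have m': "m = a + 2 + (b + Suc (Suc e))" using m by simp
  have "pow m = pow a \<otimes>\<^sub>o V \<otimes>\<^sub>o V \<otimes>\<^sub>o pow b \<otimes>\<^sub>o V \<otimes>\<^sub>o V \<otimes>\<^sub>o pow e"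
    using m' obj_pow_add[of V a "Suc (Suc (b + Suc (Suc e)))"] obj_pow_add[of V b "Suc (Suc e)"]
    by simp
  moreover have "pow (a + Suc (Suc b)) = pow a \<otimes>\<^sub>o V \<otimes>\<^sub>o V \<otimes>\<^sub>o pow b"
    "pow (b + Suc (Suc e)) = pow b \<otimes>\<^sub>o V \<otimes>\<^sub>o V \<otimes>\<^sub>o pow e"
    using obj_pow_add[of V a "Suc (Suc b)"] obj_pow_add[of V b "Suc (Suc e)"] by simp_all
  moreover have "(\<c> V V \<otimes>\<^sub>m Id (pow b) \<otimes>\<^sub>m Id (V \<otimes>\<^sub>o V)) \<cdot> (Id (V \<otimes>\<^sub>o V) \<otimes>\<^sub>m Id (pow b) \<otimes>\<^sub>m \<c> V V)
    = \<c> V V \<otimes>\<^sub>m Id (pow b) \<otimes>\<^sub>m \<c> V V"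
    "(Id (V \<otimes>\<^sub>o V) \<otimes>\<^sub>m Id (pow b) \<otimes>\<^sub>m \<c> V V) \<cdot> (\<c> V V \<otimes>\<^sub>m Id (pow b) \<otimes>\<^sub>m Id (V \<otimes>\<^sub>o V))
    = \<c> V V \<otimes>\<^sub>m Id (pow b) \<otimes>\<^sub>m \<c> V V"
    by (simp_all add: interchange del: Id_TensO)
  ultimately show ?thesis
    using interchange[of "Id (V \<otimes>\<^sub>o V) \<otimes>\<^sub>m Id (pow b) \<otimes>\<^sub>m \<c> V V" "\<c> V V \<otimes>\<^sub>m Id (pow b) \<otimes>\<^sub>m Id (V \<otimes>\<^sub>o V)" "Id (pow e)" "Id (pow e)"]
      interchange[of "\<c> V V \<otimes>\<^sub>m Id (pow b) \<otimes>\<^sub>m Id (V \<otimes>\<^sub>o V)" "Id (V \<otimes>\<^sub>o V) \<otimes>\<^sub>m Id (pow b) \<otimes>\<^sub>m \<c> V V" "Id (pow e)" "Id (pow e)"]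
    by (simp add: generator_eq[OF m' i] generator_eq[OF m j] interchange)
qed

text \<open>The Yang-Baxter equation: naturality of the braiding of \<open>V\<close> with
  \<open>V \<otimes>\<^sub>o V\<close>, applied to the morphism \<open>\<c> V V\<close>.\<close>

lemma Braid_hexagon:
  "(\<c> V V \<otimes>\<^sub>m Id V) \<cdot> (Id V \<otimes>\<^sub>m \<c> V V) \<cdot> (\<c> V V \<otimes>\<^sub>m Id V) =
   (Id V \<otimes>\<^sub>m \<c> V V) \<cdot> (\<c> V V \<otimes>\<^sub>m Id V) \<cdot> (Id V \<otimes>\<^sub>m \<c> V V)"
  using Braid_nat[of "Id V" "\<c> V V" V "V \<otimes>\<^sub>o V"] by (simp add: Braid_TensO_right)

lemma word_mor_braid:
  assumes "1 \<le> i" "Suc i < m"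
  shows "word_mor C V m [i, Suc i, i] = word_mor C V m [Suc i, i, Suc i]"
proof -
  obtain a where i: "i = Suc a" using assms(1) by (cases i) auto
  obtain b where m: "m = a + 2 + Suc b" using assms(2) i less_iff_Suc_add by fastforce
  have m': "m = Suc a + 2 + b" using m by simp
  have i': "Suc i = Suc (Suc a)" using i by simp
  have p: "pow m = pow a \<otimes>\<^sub>o V \<otimes>\<^sub>o V \<otimes>\<^sub>o V \<otimes>\<^sub>o pow b"
    using m obj_pow_add[of V a "Suc (Suc (Suc b))"] by simp
  have g: "at_pos C V (m - 2) (\<c> V V) i = Id (pow a) \<otimes>\<^sub>m (\<c> V V \<otimes>\<^sub>m Id V) \<otimes>\<^sub>m Id (pow b)"
    "at_pos C V (m - 2) (\<c> V V) (Suc i) = Id (pow a) \<otimes>\<^sub>m (Id V \<otimes>\<^sub>m \<c> V V) \<otimes>\<^sub>m Id (pow b)"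
    by (simp_all add: generator_eq[OF m i] generator_eq[OF m' i'] obj_pow_Suc_right[of V a]
      del: obj_pow.simps(2)) simp
  show ?thesis
    by (simp add: p g interchange Braid_hexagon del: TensM_assoc)
qed

text \<open>The ranges are carried along because the congruence also relates out-of-range words to
  themselves: in a chain, the middle word must be known to be in range before its morphism can be
  compared.\<close>

lemma coxeter_eq_word_mor:
  assumes "coxeter_eq m v w"
  shows "(set v \<subseteq> {1..<m} \<longleftrightarrow> set w \<subseteq> {1..<m}) \<and>
    (set v \<subseteq> {1..<m} \<longrightarrow> word_mor C V m v = word_mor C V m w)"
  using assms
proof induction
  case (coxeter_square i)
  then show ?case using word_mor_square[of i] by simp
next
  case (coxeter_commute i j)
  then show ?case using word_mor_commute[of i j] by auto
next
  case (coxeter_braid i)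
  then show ?case using word_mor_braid[of i] by auto
next
  case (coxeter_append v w v' w')
  then show ?case by (auto simp: word_mor_append)
qed auto

text \<open>Two words for one permutation are Coxeter related by
  \<open>word_perm_eq_imp_coxeter_eq\<close>, hence have the same morphism.\<close>

lemma perm_action_word_perm:
  assumes "set w \<subseteq> {1..<m}"
  shows "perm_action C V m (word_perm w) = word_mor C V m w"
  unfolding perm_action_def
proof (rule the_equality)
  show "\<exists>v. set v \<subseteq> {1..<m} \<and> word_perm v = word_perm w \<and> word_mor C V m w = word_mor C V m v"
    using assms by blast
next
  fix f
  assume "\<exists>v. set v \<subseteq> {1..<m} \<and> word_perm v = word_perm w \<and> f = word_mor C V m v"
  then show "f = word_mor C V m w"
    using assms word_perm_eq_imp_coxeter_eq coxeter_eq_word_mor by blast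
qed

lemma word_mor_add:
  assumes "set w \<subseteq> {1..<m}"
  shows "word_mor C V (m + r) w = word_mor C V m w \<otimes>\<^sub>m Id (pow r)"
  using assms
proof (induction w)
  case Nil
  show ?case by (simp add: obj_pow_add)
next
  case (Cons i w)
  obtain a where i: "i = Suc a" using Cons.prems by (cases i) auto
  obtain b where m: "m = a + 2 + b" using Cons.prems i less_iff_Suc_add by fastforce
  have m': "m + r = a + 2 + (b + r)" using m by simp
  have g: "at_pos C V (m + r - 2) (\<c> V V) i = at_pos C V (m - 2) (\<c> V V) i \<otimes>\<^sub>m Id (pow r)"
    by (simp add: generator_eq[OF m i] generator_eq[OF m' i] obj_pow_add)
  show ?case
    using Cons by (simp add: g interchange)
qed

lemma word_mor_descend:
  "word_mor C V (a + 1 + b + e) (descend (a + 1 + b) (a + 1)) =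
    Id (pow a) \<otimes>\<^sub>m \<c> V (pow b) \<otimes>\<^sub>m Id (pow e)"
proof (induction b arbitrary: e)
  case 0
  show ?case using obj_pow_add[of V a "Suc e"] by simp
next
  case (Suc b)
  have i: "a + 1 + b = Suc (a + b)" by simp
  have m: "a + 1 + Suc b + e = a + b + 2 + e" by simp
  have d: "descend (a + 1 + Suc b) (a + 1) = (a + 1 + b) # descend (a + 1 + b) (a + 1)"
    by (simp add: descend_def)
  \<comment> \<open>The induction hypothesis is used with \<open>Suc e\<close> strands on the right,
    hence the generalisation over \<open>e\<close>.\<close>
  have m': "a + 1 + Suc b + e = a + 1 + b + Suc e" by simp
  have "word_mor C V (a + 1 + Suc b + e) (descend (a + 1 + Suc b) (a + 1)) =
     (Id (pow (a + b)) \<otimes>\<^sub>m \<c> V V \<otimes>\<^sub>m Id (pow e)) \<cdot> (Id (pow a) \<otimes>\<^sub>m \<c> V (pow b) \<otimes>\<^sub>m Id (pow (Suc e)))"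
    unfolding d word_mor.simps generator_eq[OF m i] unfolding m' Suc ..
  also have "\<dots> = Id (pow a) \<otimes>\<^sub>m ((Id (pow b) \<otimes>\<^sub>m \<c> V V) \<cdot> (\<c> V (pow b) \<otimes>\<^sub>m Id V)) \<otimes>\<^sub>m Id (pow e)"
    by (simp add: obj_pow_add expand)
  also have "(Id (pow b) \<otimes>\<^sub>m \<c> V V) \<cdot> (\<c> V (pow b) \<otimes>\<^sub>m Id V) = \<c> V (pow (Suc b))"
    by (simp add: obj_pow_Suc_right Braid_TensO_right del: obj_pow.simps(2))
  finally show ?case .
qed

text \<open>Here \<open>m\<close> is \<open>i - 1\<close>. The source consists of \<open>m\<close>
  factors followed by \<open>m + 1\<close> copies of the acting one; the first copy goes to the
  front, for \<open>\<epsilon>\<close>, and each further copy to the right of the factor it acts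
  on.\<close>

definition interleave :: "nat \<Rightarrow> 'm" where
  "interleave m = perm_action C V (2 * m + 1) (theta (m + 1))"

lemma interleave_eq: "interleave m = word_mor C V (2 * m + 1) (theta_word m)"
  unfolding interleave_def word_perm_theta_word[symmetric]
  by (rule perm_action_word_perm[OF set_theta_word])

lemma interleave_simps [simp]:
  "interleave m \<in> Arr C" "Dom C (interleave m) = pow (2 * m + 1)"
  "Cod C (interleave m) = pow (2 * m + 1)"
  unfolding interleave_eq using word_mor_simps[OF set_theta_word] by simp_all

lemma interleave_0 [simp]: "interleave 0 = Id V"
  by (simp add: interleave_eq)

lemma interleave_Suc:
  "interleave (Suc m) = (interleave m \<otimes>\<^sub>m Id (V \<otimes>\<^sub>o V)) \<cdot> (Id (pow m) \<otimes>\<^sub>m \<c> V (pow (Suc m)) \<otimes>\<^sub>m Id V)"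
proof -
  have s: "set (theta_word m) \<subseteq> {1..<2 * Suc m + 1}"
    "set (descend (2 * m + 2) (m + 1)) \<subseteq> {1..<2 * Suc m + 1}"
    using set_theta_word[of m] by auto
  have "interleave (Suc m) = word_mor C V (2 * Suc m + 1) (theta_word m) \<cdot>
     word_mor C V (2 * Suc m + 1) (descend (2 * m + 2) (m + 1))"
    unfolding interleave_eq theta_word.simps by (rule word_mor_append[OF s])
  also have "word_mor C V (2 * Suc m + 1) (theta_word m) = interleave m \<otimes>\<^sub>m Id (pow 2)"
    using word_mor_add[OF set_theta_word, of m 2] by (simp add: interleave_eq)
  also have "word_mor C V (2 * Suc m + 1) (descend (2 * m + 2) (m + 1)) =
     Id (pow m) \<otimes>\<^sub>m \<c> V (pow (Suc m)) \<otimes>\<^sub>m Id (pow 1)"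
  proof -
    have "m + 1 + Suc m + 1 = 2 * Suc m + 1" "m + 1 + Suc m = 2 * m + 2" by simp_all
    then show ?thesis using word_mor_descend[of m "Suc m" 1] by metis
  qed
  finally show ?thesis by (simp add: numeral_2_eq_2)
qed

end

section \<open>Diagonal actions of a shelf\<close>

locale shelf_with_character = symmetric_category_with_object C V
  for C :: "('o, 'm, 'z) symmetric_category_scheme" (structure) and V :: 'o +
  fixes \<Delta> tri \<epsilon> :: 'm
  assumes shelf: "shelf C V \<Delta> tri"
    and character: "shelf_character C V \<Delta> tri \<epsilon>"
begin

lemma structure_simps [simp]:
  "\<Delta> \<in> Arr C" "Dom C \<Delta> = V" "Cod C \<Delta> = V \<otimes>\<^sub>o V"
  "tri \<in> Arr C" "Dom C tri = V \<otimes>\<^sub>o V" "Cod C tri = V"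
  "\<epsilon> \<in> Arr C" "Dom C \<epsilon> = V" "Cod C \<epsilon> = \<I>"
  using shelf character by (simp_all add: shelf_def shelf_character_def in_Hom_iff)

lemma character_comult: "(\<epsilon> \<otimes>\<^sub>m \<epsilon>) \<cdot> \<Delta> = \<epsilon>"
  and character_tri: "\<epsilon> \<cdot> tri = \<epsilon> \<otimes>\<^sub>m \<epsilon>"
  using character by (simp_all add: shelf_character_def)

lemma coassoc: "(\<Delta> \<otimes>\<^sub>m Id V) \<cdot> \<Delta> = (Id V \<otimes>\<^sub>m \<Delta>) \<cdot> \<Delta>"
  using shelf by (simp add: shelf_def at_pos_def)

lemma cocomm:
  "(Id V \<otimes>\<^sub>m \<c> V V \<otimes>\<^sub>m Id V) \<cdot> (\<Delta> \<otimes>\<^sub>m Id V \<otimes>\<^sub>m Id V) \<cdot> (\<Delta> \<otimes>\<^sub>m Id V) \<cdot> \<Delta> =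
    (\<Delta> \<otimes>\<^sub>m Id V \<otimes>\<^sub>m Id V) \<cdot> (\<Delta> \<otimes>\<^sub>m Id V) \<cdot> \<Delta>"
proof -
  have "at_pos C V 2 (\<c> V V) 2 \<cdot> comult_pow C V \<Delta> 3 = comult_pow C V \<Delta> 3"
    using shelf unfolding shelf_def by blast
  then show ?thesis
    by (simp add: at_pos_def numeral_3_eq_3 numeral_2_eq_2)
qed

lemma comult3: "(\<Delta> \<otimes>\<^sub>m Id V \<otimes>\<^sub>m Id V) \<cdot> (\<Delta> \<otimes>\<^sub>m Id V) \<cdot> \<Delta> =
    (Id V \<otimes>\<^sub>m \<Delta> \<otimes>\<^sub>m Id V) \<cdot> (\<Delta> \<otimes>\<^sub>m Id V) \<cdot> \<Delta>"
proof -
  have "((\<Delta> \<otimes>\<^sub>m Id V) \<cdot> \<Delta>) \<otimes>\<^sub>m Id V = ((Id V \<otimes>\<^sub>m \<Delta>) \<cdot> \<Delta>) \<otimes>\<^sub>m Id V"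
    by (simp only: coassoc)
  then have e: "(\<Delta> \<otimes>\<^sub>m Id V \<otimes>\<^sub>m Id V) \<cdot> (\<Delta> \<otimes>\<^sub>m Id V) = (Id V \<otimes>\<^sub>m \<Delta> \<otimes>\<^sub>m Id V) \<cdot> (\<Delta> \<otimes>\<^sub>m Id V)"
    by (simp add: expand)
  show ?thesis by (simp add: Comp_rewrite[OF e])
qed

text \<open>By coassociativity, in the form \<open>comult3\<close>, the two copies swapped by the
  weak axiom arise from a comultiplication of the middle one of three copies.\<close>

lemma cocomm_middle:
  "(Id V \<otimes>\<^sub>m (\<c> V V \<cdot> \<Delta>) \<otimes>\<^sub>m Id V) \<cdot> (\<Delta> \<otimes>\<^sub>m Id V) \<cdot> \<Delta> =
    (Id V \<otimes>\<^sub>m \<Delta> \<otimes>\<^sub>m Id V) \<cdot> (\<Delta> \<otimes>\<^sub>m Id V) \<cdot> \<Delta>"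
  using cocomm unfolding comult3 by (simp add: expand)

abbreviation diag :: "'o \<Rightarrow> 'm \<Rightarrow> 'm" where
  "diag X \<rho> \<equiv> conv X V V V \<Delta> \<rho> tri"

abbreviation tri2 :: 'm where "tri2 \<equiv> diag V tri"

text \<open>Axiom (2), read as equivariance of \<open>tri\<close> for the diagonal action on its
  source.\<close>

lemma self_distributive: "tri \<cdot> (tri \<otimes>\<^sub>m Id V) = tri \<cdot> tri2"
  using shelf by (simp add: shelf_def at_pos_def conv_def numeral_2_eq_2)

text \<open>Axiom (3) becomes equivariance of \<open>\<Delta>\<close> once the copying of the acting
  strand is split off from \<open>\<Delta> \<otimes>\<^sub>m \<Delta>\<close>.\<close>

lemma comult_tri: "\<Delta> \<cdot> tri = tri2 \<cdot> (\<Delta> \<otimes>\<^sub>m Id V)"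
proof -
  have "\<Delta> \<cdot> tri = (tri \<otimes>\<^sub>m tri) \<cdot> (Id V \<otimes>\<^sub>m \<c> V V \<otimes>\<^sub>m Id V) \<cdot> (\<Delta> \<otimes>\<^sub>m \<Delta>)"
    using shelf by (simp add: shelf_def at_pos_def numeral_2_eq_2)
  also have "\<Delta> \<otimes>\<^sub>m \<Delta> = (Id (V \<otimes>\<^sub>o V) \<otimes>\<^sub>m \<Delta>) \<cdot> (\<Delta> \<otimes>\<^sub>m Id V)"
    by (simp add: interchange del: Id_TensO)
  finally show ?thesis by (simp add: conv_def)
qed

text \<open>Coassociativity regroups the copies of the acting strand, so that the last two factors
  form a single one with action \<open>tri2\<close>.\<close>

lemma diag_diag:
  assumes [simp]: "X \<in> Obj C" "\<rho> \<in> Arr C" "Dom C \<rho> = X \<otimes>\<^sub>o V"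
  shows "diag (X \<otimes>\<^sub>o V) (diag X \<rho>) = conv X (V \<otimes>\<^sub>o V) V V \<Delta> \<rho> tri2"
  by (rule conv_assoc) (simp_all add: coassoc)

text \<open>The inductive step of the intertwining principle. Naturality collects two copies of
  \<open>g\<close> behind \<open>\<Delta>\<close>; compatibility of \<open>g\<close> with
  \<open>\<Delta>\<close> merges them into one \<open>g\<close> on the acting strand.\<close>

lemma diag_twist:
  assumes [simp]: "X \<in> Obj C" "X' \<in> Obj C"
    "\<rho> \<in> Arr C" "Dom C \<rho> = X \<otimes>\<^sub>o V" "Cod C \<rho> = X"
    "\<rho>' \<in> Arr C" "Dom C \<rho>' = X' \<otimes>\<^sub>o V"
    "f \<in> Arr C" "Dom C f = X" "Cod C f = X'" "g \<in> Arr C" "Dom C g = V" "Cod C g = V"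
    and g: "\<Delta> \<cdot> g = (g \<otimes>\<^sub>m g) \<cdot> \<Delta>" "g \<cdot> tri = tri \<cdot> (g \<otimes>\<^sub>m g)"
    and f: "f \<cdot> \<rho> = \<rho>' \<cdot> (f \<otimes>\<^sub>m g)"
  shows "(f \<otimes>\<^sub>m g) \<cdot> diag X \<rho> = diag X' \<rho>' \<cdot> (f \<otimes>\<^sub>m g \<otimes>\<^sub>m g)"
proof -
  have "(f \<otimes>\<^sub>m g) \<cdot> diag X \<rho> = conv X V V V \<Delta> (\<rho>' \<cdot> (f \<otimes>\<^sub>m g)) (tri \<cdot> (g \<otimes>\<^sub>m g))"
    by (simp add: conv_comp f g(2))
  also have "\<dots> = conv X' V V V (\<Delta> \<cdot> g) \<rho>' tri \<cdot> (f \<otimes>\<^sub>m g \<otimes>\<^sub>m Id V)"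
    unfolding g(1) by (rule conv_natural) simp_all
  also have "\<dots> = diag X' \<rho>' \<cdot> (Id X' \<otimes>\<^sub>m Id V \<otimes>\<^sub>m g) \<cdot> (f \<otimes>\<^sub>m g \<otimes>\<^sub>m Id V)"
    by (subst conv_precomp) simp_all
  finally show ?thesis by (simp add: interchange)
qed

text \<open>\<open>diag_diag\<close> reduces this to the equivariance of \<open>\<Delta>\<close> in
  \<open>comult_tri\<close>.\<close>

lemma diag_comult:
  assumes [simp]: "X \<in> Obj C" "\<rho> \<in> Arr C" "Dom C \<rho> = X \<otimes>\<^sub>o V" "Cod C \<rho> = X"
  shows "(Id X \<otimes>\<^sub>m \<Delta>) \<cdot> diag X \<rho> = diag (X \<otimes>\<^sub>o V) (diag X \<rho>) \<cdot> (Id X \<otimes>\<^sub>m \<Delta> \<otimes>\<^sub>m Id V)"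
  by (simp add: diag_diag conv_comp comult_tri conv_right)

text \<open>
  Weak cocommutativity swaps only inner copies; the factor \<open>V\<close> to the right of the two exchanged
  ones is therefore essential here.
\<close>

lemma diag_Braid:
  assumes [simp]: "X \<in> Obj C" "\<rho> \<in> Arr C" "Dom C \<rho> = X \<otimes>\<^sub>o V" "Cod C \<rho> = X"
  defines "\<rho>3 \<equiv> diag (X \<otimes>\<^sub>o V \<otimes>\<^sub>o V) (diag (X \<otimes>\<^sub>o V) (diag X \<rho>))"
  shows "(Id X \<otimes>\<^sub>m \<c> V V \<otimes>\<^sub>m Id V) \<cdot> \<rho>3 = \<rho>3 \<cdot> (Id X \<otimes>\<^sub>m \<c> V V \<otimes>\<^sub>m Id V \<otimes>\<^sub>m Id V)"
proof -
  let ?W = "V \<otimes>\<^sub>o V" let ?\<kappa> = "conv V V V V (Id V \<otimes>\<^sub>m Id V) tri tri"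
  \<comment> \<open>\<open>G h\<close> is \<open>\<rho>3\<close> with \<open>h\<close> in place of
    the comultiplication that supplies the two factors to be exchanged. The swap thus affects
    \<open>h\<close> alone.\<close>
  define G where "G h = diag (X \<otimes>\<^sub>o ?W) (conv X ?W V V \<Delta> \<rho> (conv V V V V h tri tri))" for h
  have \<rho>3: "\<rho>3 = G \<Delta>"
    unfolding \<rho>3_def G_def by (simp add: diag_diag)
  \<comment> \<open>All copies are made first, so that \<open>h\<close> sits in the middle of three
    copies as in \<open>cocomm_middle\<close>; \<open>?\<kappa>\<close> then lets two separate
    strands act on two factors.\<close>
  have G: "G h = conv X (?W \<otimes>\<^sub>o V) V (V \<otimes>\<^sub>o ?W) ((Id V \<otimes>\<^sub>m h \<otimes>\<^sub>m Id V) \<cdot> (\<Delta> \<otimes>\<^sub>m Id V) \<cdot> \<Delta>) \<rho>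
      (conv ?W V ?W V (Id (?W \<otimes>\<^sub>o V)) ?\<kappa> tri)"
    if [simp]: "h \<in> Arr C" "Dom C h = V" "Cod C h = ?W" for h
  proof -
    have "conv V V V V h tri tri = ?\<kappa> \<cdot> (Id ?W \<otimes>\<^sub>m h)"
      using conv_precomp[of V V V V tri tri "Id ?W" h] by simp
    moreover have "conv X ?W V V \<Delta> (\<rho> \<cdot> (Id X \<otimes>\<^sub>m Id V)) (?\<kappa> \<cdot> (Id ?W \<otimes>\<^sub>m h)) =
       conv X ?W V ?W ((Id V \<otimes>\<^sub>m h) \<cdot> \<Delta>) \<rho> ?\<kappa> \<cdot> (Id X \<otimes>\<^sub>m Id ?W \<otimes>\<^sub>m Id V)"
      by (rule conv_natural) simp_all
    ultimately have e: "conv X ?W V V \<Delta> \<rho> (conv V V V V h tri tri) =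
       conv X ?W V ?W ((Id V \<otimes>\<^sub>m h) \<cdot> \<Delta>) \<rho> ?\<kappa>"
      by simp
    have e': "((Id V \<otimes>\<^sub>m h) \<cdot> \<Delta>) \<otimes>\<^sub>m Id V = (Id V \<otimes>\<^sub>m h \<otimes>\<^sub>m Id V) \<cdot> (\<Delta> \<otimes>\<^sub>m Id V)"
      by (simp add: expand)
    show ?thesis unfolding G_def e
      by (rule conv_assoc[where P = V and ?P2.0 = "V \<otimes>\<^sub>o ?W"]) (simp_all add: e')
  qed
  have "(Id X \<otimes>\<^sub>m \<c> V V \<otimes>\<^sub>m Id V) \<cdot> G \<Delta> = ((Id X \<otimes>\<^sub>m \<c> V V) \<otimes>\<^sub>m Id V) \<cdot> G \<Delta>"
    by simp
  also have "\<dots> = conv (X \<otimes>\<^sub>o ?W) V V V \<Delta> ((Id X \<otimes>\<^sub>m \<c> V V) \<cdot> conv X ?W V V \<Delta> \<rho> tri2) (Id V \<cdot> tri)"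
    unfolding G_def by (rule conv_comp) simp_all
  also have "(Id X \<otimes>\<^sub>m \<c> V V) \<cdot> conv X ?W V V \<Delta> \<rho> tri2 = conv X ?W V V \<Delta> (Id X \<cdot> \<rho>) (\<c> V V \<cdot> tri2)"
    by (rule conv_comp) simp_all
  also have "Id X \<cdot> \<rho> = \<rho>" by simp
  also have "Id V \<cdot> tri = tri" by simp
  \<comment> \<open>The swap of the outputs becomes a swap of the inputs, which leaves on the right,
    and a swap of the legs of \<open>\<Delta>\<close>.\<close>
  also have "\<c> V V \<cdot> tri2 = conv V V V V (\<c> V V \<cdot> \<Delta>) tri tri \<cdot> (\<c> V V \<otimes>\<^sub>m Id V)"
    by (rule Braid_conv) simp_all
  also have "conv X ?W V V \<Delta> \<rho> \<dots> =
     conv X ?W V V \<Delta> \<rho> (conv V V V V (\<c> V V \<cdot> \<Delta>) tri tri) \<cdot> ((Id X \<otimes>\<^sub>m \<c> V V) \<otimes>\<^sub>m Id V)"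
    by (subst conv_right) simp_all
  also have "diag (X \<otimes>\<^sub>o ?W) \<dots> = G (\<c> V V \<cdot> \<Delta>) \<cdot> ((Id X \<otimes>\<^sub>m \<c> V V) \<otimes>\<^sub>m Id V \<otimes>\<^sub>m Id V)"
    unfolding G_def by (rule conv_left) simp_all
  \<comment> \<open>By the formula \<open>G\<close>, both sides depend on \<open>h\<close> only
    through the threefold comultiplication, where \<open>cocomm_middle\<close> identifies
    them.\<close>
  also have "G (\<c> V V \<cdot> \<Delta>) = G \<Delta>"
    by (simp only: G structure_simps Braid_simps Comp_simps V cocomm_middle)
  finally show ?thesis by (simp add: \<rho>3)
qed

text \<open>Grouped as an action on \<open>(X \<otimes> V) \<otimes> (V \<otimes> V)\<close>, the
  claim splits into equivariance of \<open>\<rho>\<close>, which is the hypothesis, and of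
  \<open>tri\<close>, which is axiom (2).\<close>

lemma diag_tri:
  assumes [simp]: "X \<in> Obj C" "\<rho> \<in> Arr C" "Dom C \<rho> = X \<otimes>\<^sub>o V" "Cod C \<rho> = X"
    and \<rho>: "\<rho> \<cdot> (\<rho> \<otimes>\<^sub>m Id V) = \<rho> \<cdot> diag X \<rho>"
  shows "(\<rho> \<otimes>\<^sub>m tri) \<cdot> diag (X \<otimes>\<^sub>o V \<otimes>\<^sub>o V) (diag (X \<otimes>\<^sub>o V) (diag X \<rho>)) =
    diag X \<rho> \<cdot> (\<rho> \<otimes>\<^sub>m tri \<otimes>\<^sub>m Id V)"
proof -
  have "diag (X \<otimes>\<^sub>o V \<otimes>\<^sub>o V) (diag (X \<otimes>\<^sub>o V) (diag X \<rho>)) =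
    conv (X \<otimes>\<^sub>o V) (V \<otimes>\<^sub>o V) V V \<Delta> (diag X \<rho>) tri2"
    using diag_diag[of "X \<otimes>\<^sub>o V" "diag X \<rho>"] by simp
  then have "(\<rho> \<otimes>\<^sub>m tri) \<cdot> diag (X \<otimes>\<^sub>o V \<otimes>\<^sub>o V) (diag (X \<otimes>\<^sub>o V) (diag X \<rho>)) =
    conv (X \<otimes>\<^sub>o V) (V \<otimes>\<^sub>o V) V V \<Delta> (\<rho> \<cdot> (\<rho> \<otimes>\<^sub>m Id V)) (tri \<cdot> (tri \<otimes>\<^sub>m Id V))"
    by (simp add: conv_comp \<rho> self_distributive)
  also have "\<dots> = conv X V V V ((Id V \<otimes>\<^sub>m Id V) \<cdot> \<Delta>) \<rho> tri \<cdot> (\<rho> \<otimes>\<^sub>m tri \<otimes>\<^sub>m Id V)"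
    by (rule conv_natural) simp_all
  finally show ?thesis by simp
qed

lemma diag_self_distributive:
  assumes [simp]: "X \<in> Obj C" "\<rho> \<in> Arr C" "Dom C \<rho> = X \<otimes>\<^sub>o V" "Cod C \<rho> = X"
    and \<rho>: "\<rho> \<cdot> (\<rho> \<otimes>\<^sub>m Id V) = \<rho> \<cdot> diag X \<rho>"
  shows "diag X \<rho> \<cdot> (diag X \<rho> \<otimes>\<^sub>m Id V) = diag X \<rho> \<cdot> diag (X \<otimes>\<^sub>o V) (diag X \<rho>)"
proof -
  let ?F = "\<rho> \<otimes>\<^sub>m tri" let ?K = "Id X \<otimes>\<^sub>m \<c> V V \<otimes>\<^sub>m Id V" let ?D = "Id X \<otimes>\<^sub>m Id V \<otimes>\<^sub>m \<Delta>"
  let ?d = "diag X \<rho>" let ?d2 = "diag (X \<otimes>\<^sub>o V) ?d"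
  let ?d3 = "diag (X \<otimes>\<^sub>o V \<otimes>\<^sub>o V) ?d2"
  have d: "?d = ?F \<cdot> ?K \<cdot> ?D" by (simp add: conv_def)
  have F: "?F \<cdot> ?d3 = ?d \<cdot> (?F \<otimes>\<^sub>m Id V)"
    using diag_tri[OF assms] by simp
  have K: "?K \<cdot> ?d3 = ?d3 \<cdot> (?K \<otimes>\<^sub>m Id V)"
    using diag_Braid[OF assms(1-4)] by simp
  have D: "?D \<cdot> ?d2 = ?d3 \<cdot> (?D \<otimes>\<^sub>m Id V)"
    using diag_comult[of "X \<otimes>\<^sub>o V" ?d] by simp
  \<comment> \<open>The diagonal action is moved to the left past \<open>?D\<close>,
    \<open>?K\<close> and \<open>?F\<close> in turn.\<close>
  have "?d \<cdot> ?d2 = ?F \<cdot> ?K \<cdot> ?D \<cdot> ?d2"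
    by (subst d) simp
  also have "\<dots> = ?F \<cdot> (?K \<cdot> ?d3) \<cdot> (?D \<otimes>\<^sub>m Id V)"
    by (subst D) simp
  also have "\<dots> = (?F \<cdot> ?d3) \<cdot> (?K \<otimes>\<^sub>m Id V) \<cdot> (?D \<otimes>\<^sub>m Id V)"
    by (subst K) simp
  also have "\<dots> = ?d \<cdot> (?F \<otimes>\<^sub>m Id V) \<cdot> (?K \<otimes>\<^sub>m Id V) \<cdot> (?D \<otimes>\<^sub>m Id V)"
    by (subst F) simp
  also have "(?F \<otimes>\<^sub>m Id V) \<cdot> (?K \<otimes>\<^sub>m Id V) \<cdot> (?D \<otimes>\<^sub>m Id V) = (?F \<cdot> ?K \<cdot> ?D) \<otimes>\<^sub>m Id V"
    by (simp add: expand)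
  finally show ?thesis by (simp only: d[symmetric])
qed

section \<open>The endomorphism \<open>\<chi>\<close> of the shelf\<close>

abbreviation \<chi> :: 'm where "\<chi> \<equiv> chi C V \<Delta> \<epsilon>"

lemma chi_eq: "\<chi> = (Id V \<otimes>\<^sub>m \<epsilon>) \<cdot> \<Delta>"
  by (simp add: chi_def at_pos_def)

lemma chi_simps [simp]: "\<chi> \<in> Arr C" "Dom C \<chi> = V" "Cod C \<chi> = V"
  by (simp_all add: chi_eq)

lemma character_chi: "\<epsilon> \<cdot> \<chi> = \<epsilon>"
proof -
  have "\<epsilon> \<cdot> (Id V \<otimes>\<^sub>m \<epsilon>) = \<epsilon> \<otimes>\<^sub>m \<epsilon>"
    using interchange[of "Id V" \<epsilon> \<epsilon> "Id \<I>"] by simp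
  from Comp_rewrite[OF this, of \<Delta>] show ?thesis
    by (simp add: chi_eq character_comult)
qed

text \<open>Since \<open>\<epsilon>\<close> turns \<open>tri\<close> into
  \<open>\<epsilon> \<otimes>\<^sub>m \<epsilon>\<close>, the second copy of the acting strand is
  discarded, which leaves \<open>\<chi>\<close> of that strand. Hence
  \<open>Id \<otimes> \<epsilon>\<close> is equivariant up to \<open>\<chi>\<close>.\<close>

lemma diag_character:
  assumes [simp]: "X \<in> Obj C" "\<rho> \<in> Arr C" "Dom C \<rho> = X \<otimes>\<^sub>o V" "Cod C \<rho> = X"
  shows "(Id X \<otimes>\<^sub>m \<epsilon>) \<cdot> diag X \<rho> = \<rho> \<cdot> (Id X \<otimes>\<^sub>m \<epsilon> \<otimes>\<^sub>m \<chi>)"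
proof -
  have "(Id X \<otimes>\<^sub>m \<epsilon>) \<cdot> diag X \<rho> = conv X V V V \<Delta> (\<rho> \<cdot> (Id X \<otimes>\<^sub>m Id V)) (Id \<I> \<cdot> (\<epsilon> \<otimes>\<^sub>m \<epsilon>))"
    by (simp add: conv_comp character_tri)
  also have "\<dots> = conv X \<I> V \<I> ((Id V \<otimes>\<^sub>m \<epsilon>) \<cdot> \<Delta>) \<rho> (Id \<I>) \<cdot> (Id X \<otimes>\<^sub>m \<epsilon> \<otimes>\<^sub>m Id V)"
    by (rule conv_natural) simp_all
  also have "\<dots> = \<rho> \<cdot> (Id X \<otimes>\<^sub>m \<chi>) \<cdot> (Id X \<otimes>\<^sub>m \<epsilon> \<otimes>\<^sub>m Id V)"
    by (simp add: conv_def chi_eq)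
  also have "(Id X \<otimes>\<^sub>m \<chi>) \<cdot> (Id X \<otimes>\<^sub>m \<epsilon> \<otimes>\<^sub>m Id V) = Id X \<otimes>\<^sub>m \<epsilon> \<otimes>\<^sub>m \<chi>"
    using slide[of \<epsilon> \<chi> \<I> V] by (simp add: interchange)
  finally show ?thesis .
qed

text \<open>The second output of \<open>comult_tri\<close> is discarded, using
  \<open>diag_character\<close> for \<open>X = V\<close>.\<close>

lemma chi_tri: "\<chi> \<cdot> tri = tri \<cdot> (\<chi> \<otimes>\<^sub>m \<chi>)"
proof -
  have "\<chi> \<cdot> tri = ((Id V \<otimes>\<^sub>m \<epsilon>) \<cdot> tri2) \<cdot> (\<Delta> \<otimes>\<^sub>m Id V)"
    by (simp add: chi_eq comult_tri)
  also have "\<dots> = tri \<cdot> (Id V \<otimes>\<^sub>m \<epsilon> \<otimes>\<^sub>m \<chi>) \<cdot> (\<Delta> \<otimes>\<^sub>m Id V)"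
    by (simp add: diag_character)
  also have "(Id V \<otimes>\<^sub>m \<epsilon> \<otimes>\<^sub>m \<chi>) \<cdot> (\<Delta> \<otimes>\<^sub>m Id V) = \<chi> \<otimes>\<^sub>m \<chi>"
    using interchange[of \<Delta> "Id V \<otimes>\<^sub>m \<epsilon>" "Id V" \<chi>] by (simp add: chi_eq)
  finally show ?thesis .
qed

text \<open>The right-hand side makes four copies and discards the second and fourth. Weak
  cocommutativity lets the third and fourth be discarded instead, and these merge by
  \<open>character_comult\<close>.\<close>

lemma comult_chi: "\<Delta> \<cdot> \<chi> = (\<chi> \<otimes>\<^sub>m \<chi>) \<cdot> \<Delta>"
proof -
  let ?\<Delta>3 = "(\<Delta> \<otimes>\<^sub>m Id V \<otimes>\<^sub>m Id V) \<cdot> (\<Delta> \<otimes>\<^sub>m Id V) \<cdot> \<Delta>"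
  have e: "(\<Delta> \<otimes>\<^sub>m \<Delta>) \<cdot> \<Delta> = ?\<Delta>3"
  proof -
    have "(\<Delta> \<otimes>\<^sub>m \<Delta>) = (\<Delta> \<otimes>\<^sub>m Id V \<otimes>\<^sub>m Id V) \<cdot> (Id V \<otimes>\<^sub>m \<Delta>)"
      using interchange[of "Id V" \<Delta> \<Delta> "Id (V \<otimes>\<^sub>o V)"] by simp
    then show ?thesis by (simp add: coassoc)
  qed
  have "(\<chi> \<otimes>\<^sub>m \<chi>) \<cdot> \<Delta> = (Id V \<otimes>\<^sub>m \<epsilon> \<otimes>\<^sub>m Id V \<otimes>\<^sub>m \<epsilon>) \<cdot> (\<Delta> \<otimes>\<^sub>m \<Delta>) \<cdot> \<Delta>"
    using Comp_rewrite[OF interchange[of \<Delta> "Id V \<otimes>\<^sub>m \<epsilon>" \<Delta> "Id V \<otimes>\<^sub>m \<epsilon>"], of \<Delta>]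
    by (simp add: chi_eq)
  also have "\<dots> = (Id V \<otimes>\<^sub>m \<epsilon> \<otimes>\<^sub>m Id V \<otimes>\<^sub>m \<epsilon>) \<cdot> (Id V \<otimes>\<^sub>m \<c> V V \<otimes>\<^sub>m Id V) \<cdot> ?\<Delta>3"
    by (simp only: e cocomm)
  also have "\<dots> = (Id V \<otimes>\<^sub>m Id V \<otimes>\<^sub>m \<epsilon> \<otimes>\<^sub>m \<epsilon>) \<cdot> ?\<Delta>3"
  proof -
    have e: "(\<epsilon> \<otimes>\<^sub>m Id V) \<cdot> \<c> V V = Id V \<otimes>\<^sub>m \<epsilon>"
      using Braid_nat[of "Id V" \<epsilon> V \<I>] by simp
    have "(Id V \<otimes>\<^sub>m (\<epsilon> \<otimes>\<^sub>m Id V) \<otimes>\<^sub>m \<epsilon>) \<cdot> (Id V \<otimes>\<^sub>m \<c> V V \<otimes>\<^sub>m Id V) =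
      Id V \<otimes>\<^sub>m ((\<epsilon> \<otimes>\<^sub>m Id V) \<cdot> \<c> V V) \<otimes>\<^sub>m \<epsilon>"
      by (simp add: interchange del: TensM_assoc)
    then have "(Id V \<otimes>\<^sub>m \<epsilon> \<otimes>\<^sub>m Id V \<otimes>\<^sub>m \<epsilon>) \<cdot> (Id V \<otimes>\<^sub>m \<c> V V \<otimes>\<^sub>m Id V) = Id V \<otimes>\<^sub>m Id V \<otimes>\<^sub>m \<epsilon> \<otimes>\<^sub>m \<epsilon>"
      by (simp add: e)
    from Comp_rewrite[OF this, of ?\<Delta>3] show ?thesis
      by simp
  qed
  also have "\<dots> = (Id V \<otimes>\<^sub>m Id V \<otimes>\<^sub>m \<epsilon> \<otimes>\<^sub>m \<epsilon>) \<cdot> (Id V \<otimes>\<^sub>m Id V \<otimes>\<^sub>m \<Delta>) \<cdot> (\<Delta> \<otimes>\<^sub>m Id V) \<cdot> \<Delta>"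
  proof -
    have "(Id V \<otimes>\<^sub>m Id V \<otimes>\<^sub>m \<Delta>) \<cdot> (\<Delta> \<otimes>\<^sub>m Id V) = \<Delta> \<otimes>\<^sub>m \<Delta>"
      using interchange[of \<Delta> "Id (V \<otimes>\<^sub>o V)" "Id V" \<Delta>] by simp
    from Comp_rewrite[OF this, of \<Delta>] show ?thesis by (simp add: e)
  qed
  also have "\<dots> = (Id V \<otimes>\<^sub>m Id V \<otimes>\<^sub>m \<epsilon>) \<cdot> (\<Delta> \<otimes>\<^sub>m Id V) \<cdot> \<Delta>"
    by (simp add: interchange interchange_Comp character_comult)
  also have "\<dots> = \<Delta> \<cdot> \<chi>"
  proof -
    have "(Id V \<otimes>\<^sub>m Id V \<otimes>\<^sub>m \<epsilon>) \<cdot> (\<Delta> \<otimes>\<^sub>m Id V) = \<Delta> \<cdot> (Id V \<otimes>\<^sub>m \<epsilon>)"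
      using interchange[of \<Delta> "Id (V \<otimes>\<^sub>o V)" "Id V" \<epsilon>] interchange[of "Id V" \<Delta> \<epsilon> "Id \<I>"] by simp
    from Comp_rewrite[OF this, of \<Delta>] show ?thesis by (simp add: chi_eq)
  qed
  finally show ?thesis by simp
qed


section \<open>The diagonal actions \<open>A m\<close> on tensor powers of \<open>V\<close>\<close>

primrec action :: "nat \<Rightarrow> 'm" where
  "action 0 = \<epsilon>"
| "action (Suc m) = diag (pow m) (action m)"

lemma action_simps [simp]:
  "action m \<in> Arr C" "Dom C (action m) = pow m \<otimes>\<^sub>o V" "Cod C (action m) = pow m"
  by (induction m) (simp_all add: obj_pow_Suc_right del: obj_pow.simps(2))

lemma action_self_distributive:
  "action m \<cdot> (action m \<otimes>\<^sub>m Id V) = action m \<cdot> action (Suc m)"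
proof (induction m)
  case 0
  \<comment> \<open>Base case: \<open>diag_character\<close> with the unit object as
    \<open>X\<close> introduces \<open>\<chi>\<close> on the acting strand, and
    \<open>\<epsilon>\<close> does not see it.\<close>
  have "\<epsilon> \<cdot> diag \<I> \<epsilon> = \<epsilon> \<cdot> (\<epsilon> \<otimes>\<^sub>m \<chi>)"
    using diag_character[of \<I> \<epsilon>] by simp
  also have "\<dots> = \<epsilon> \<cdot> (\<epsilon> \<otimes>\<^sub>m Id V)"
    using interchange[of \<epsilon> "Id \<I>" \<chi> \<epsilon>] interchange[of \<epsilon> "Id \<I>" "Id V" \<epsilon>]
    by (simp add: character_chi)
  finally show ?case by simp
next
  case (Suc m)
  then show ?case
    using diag_self_distributive[of "pow m" "action m"]
    by (simp add: obj_pow_Suc_right del: obj_pow.simps(2))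
qed

text \<open>Equalities of objects, independent of the braiding; they bring the sources and targets
  of different bracketings to a common form.\<close>

lemma pow_commute: "pow n \<otimes>\<^sub>o V = V \<otimes>\<^sub>o pow n"
  "A \<in> Obj C \<Longrightarrow> pow n \<otimes>\<^sub>o V \<otimes>\<^sub>o A = V \<otimes>\<^sub>o pow n \<otimes>\<^sub>o A"
  by (induction n) simp_all

text \<open>The intertwining principle itself: \<open>diag_twist\<close> is iterated over the
  \<open>b\<close> factors appended on the right.\<close>

lemma action_twist:
  assumes "f \<in> Arr C" "Dom C f = pow a" "Cod C f = pow a'" "g \<in> Arr C" "Dom C g = V" "Cod C g = V"
    and "\<Delta> \<cdot> g = (g \<otimes>\<^sub>m g) \<cdot> \<Delta>" "g \<cdot> tri = tri \<cdot> (g \<otimes>\<^sub>m g)"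
    and "f \<cdot> action a = action a' \<cdot> (f \<otimes>\<^sub>m g)"
  shows "(f \<otimes>\<^sub>m mor_pow C g b) \<cdot> action (a + b) = action (a' + b) \<cdot> (f \<otimes>\<^sub>m mor_pow C g b \<otimes>\<^sub>m g)"
proof (induction b)
  case 0
  show ?case using assms by simp
next
  case (Suc b)
  have "((f \<otimes>\<^sub>m mor_pow C g b) \<otimes>\<^sub>m g) \<cdot> action (Suc (a + b)) =
    action (Suc (a' + b)) \<cdot> ((f \<otimes>\<^sub>m mor_pow C g b) \<otimes>\<^sub>m g \<otimes>\<^sub>m g)"
    unfolding action.simps using assms Suc by (intro diag_twist) (simp_all add: obj_pow_add)
  then show ?case
    using assms by (simp only: mor_pow_Suc_right add_Suc_right) (simp add: mor_pow_simps del: action.simps)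
qed

section \<open>Faces and degeneracies\<close>

lemma comult_pow_simps [simp]:
  "comult_pow C V \<Delta> n \<in> Arr C" "Dom C (comult_pow C V \<Delta> n) = V"
  "Cod C (comult_pow C V \<Delta> n) = pow (Suc n)"
  by (induction n) (simp_all add: at_pos_def)

text \<open>The last copy is split off first, as in the recursion of \<open>action\<close>, whereas
  \<open>comult_pow\<close> makes its newest copy at the end.\<close>

lemma comult_pow_Suc_right:
  "comult_pow C V \<Delta> (Suc n) = (comult_pow C V \<Delta> n \<otimes>\<^sub>m Id V) \<cdot> \<Delta>"
proof (induction n)
  case 0
  show ?case by (simp add: at_pos_def)
next
  case (Suc n)
  have "comult_pow C V \<Delta> (Suc (Suc n)) =
    (\<Delta> \<otimes>\<^sub>m Id (pow n \<otimes>\<^sub>o V)) \<cdot> (comult_pow C V \<Delta> n \<otimes>\<^sub>m Id V) \<cdot> \<Delta>"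
    unfolding comult_pow.simps(2)[of _ _ _ "Suc n"] Suc
    by (simp add: at_pos_def obj_pow_Suc_right del: obj_pow.simps(2) mor_pow.simps(2))
  also have "\<dots> = (((\<Delta> \<otimes>\<^sub>m Id (pow n)) \<cdot> comult_pow C V \<Delta> n) \<otimes>\<^sub>m Id V) \<cdot> \<Delta>"
    by (simp add: expand)
  finally show ?case by (simp add: at_pos_def)
qed

lemma obj_pow_double: "V \<otimes>\<^sub>o obj_pow C (V \<otimes>\<^sub>o V) m = pow (2 * m + 1)"
  by (induction m) simp_all

lemma pow_odd: "pow (2 * m + 1) = pow m \<otimes>\<^sub>o pow (Suc m)"
  using obj_pow_add[of V m "Suc m"] by (simp add: mult_2)

text \<open>The part of a left face that follows the copying of the acting strand.\<close>

definition shuffled_tri :: "nat \<Rightarrow> 'm" where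
  "shuffled_tri m = (\<epsilon> \<otimes>\<^sub>m mor_pow C tri m) \<cdot> interleave m"

lemma shuffled_tri_simps [simp]:
  "shuffled_tri m \<in> Arr C" "Dom C (shuffled_tri m) = pow m \<otimes>\<^sub>o pow (Suc m)"
  "Cod C (shuffled_tri m) = pow m"
  using obj_pow_double[of m] pow_odd[of m] by (simp_all add: shuffled_tri_def)

text \<open>Identifies the recursion with the explicit face formula. \<open>interleave_Suc\<close>
  and \<open>comult_pow_Suc_right\<close> split off the last \<open>tri\<close> and its copy;
  \<open>conv_natural\<close> then moves the remaining comultiplications from the first leg to
  \<open>shuffled_tri m\<close>.\<close>

lemma action_eq: "action m = shuffled_tri m \<cdot> (Id (pow m) \<otimes>\<^sub>m comult_pow C V \<Delta> m)"
proof (induction m)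
  case 0
  show ?case by (simp add: shuffled_tri_def)
next
  case (Suc m)
  let ?\<delta> = "(comult_pow C V \<Delta> m \<otimes>\<^sub>m Id V) \<cdot> \<Delta>"
  let ?s = "Id (pow m) \<otimes>\<^sub>m \<c> V (pow (Suc m)) \<otimes>\<^sub>m Id V"
  note [simp del] = interleave_simps(2,3) obj_pow.simps(2) comult_pow.simps(2)
  have [simp]: "Dom C (interleave m) = pow m \<otimes>\<^sub>o pow (Suc m)" "Cod C (interleave m) = V \<otimes>\<^sub>o obj_pow C (V \<otimes>\<^sub>o V) m"
    by (simp_all only: interleave_simps pow_odd obj_pow_double)
  have e: "(((\<epsilon> \<otimes>\<^sub>m mor_pow C tri m) \<otimes>\<^sub>m tri) \<cdot> (interleave m \<otimes>\<^sub>m Id (V \<otimes>\<^sub>o V))) = shuffled_tri m \<otimes>\<^sub>m tri"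
    unfolding shuffled_tri_def by (subst interchange) simp_all
  have "shuffled_tri (Suc m) = ((\<epsilon> \<otimes>\<^sub>m mor_pow C tri m) \<otimes>\<^sub>m tri) \<cdot> (interleave m \<otimes>\<^sub>m Id (V \<otimes>\<^sub>o V)) \<cdot> ?s"
    unfolding shuffled_tri_def interleave_Suc by (simp add: mor_pow_Suc_right del: mor_pow.simps(2))
  also have "\<dots> = (shuffled_tri m \<otimes>\<^sub>m tri) \<cdot> ?s"
    by (rule Comp_rewrite[OF e]) simp_all
  finally have "shuffled_tri (Suc m) \<cdot> (Id (pow (Suc m)) \<otimes>\<^sub>m comult_pow C V \<Delta> (Suc m)) =
      ((shuffled_tri m \<otimes>\<^sub>m tri) \<cdot> ?s) \<cdot> (Id (pow m \<otimes>\<^sub>o V) \<otimes>\<^sub>m ?\<delta>)"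
    by (simp only: obj_pow_Suc_right[OF V, of m, symmetric] comult_pow_Suc_right)
  also have "\<dots> = conv (pow m) V (pow (Suc m)) V ?\<delta> (shuffled_tri m) tri"
    unfolding conv_def by (rule Comp_assoc') simp_all
  also have "\<dots> = conv (pow m) V V V \<Delta> (shuffled_tri m \<cdot> (Id (pow m) \<otimes>\<^sub>m comult_pow C V \<Delta> m)) (tri \<cdot> (Id V \<otimes>\<^sub>m Id V))"
  proof -
    let ?c = "conv (pow m) V (pow (Suc m)) V ((comult_pow C V \<Delta> m \<otimes>\<^sub>m Id V) \<cdot> \<Delta>) (shuffled_tri m) tri"
    have c: "?c \<in> Arr C" by (simp del: obj_pow.simps(2) comult_pow.simps(2))
    have c': "Dom C ?c = pow m \<otimes>\<^sub>o V \<otimes>\<^sub>o V"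
      by (simp del: obj_pow.simps(2) comult_pow.simps(2))
    have "conv (pow m) V V V \<Delta> (shuffled_tri m \<cdot> (Id (pow m) \<otimes>\<^sub>m comult_pow C V \<Delta> m)) (tri \<cdot> (Id V \<otimes>\<^sub>m Id V)) =
      ?c \<cdot> (Id (pow m) \<otimes>\<^sub>m Id V \<otimes>\<^sub>m Id V)"
      by (rule conv_natural) (simp_all del: obj_pow.simps(2) comult_pow.simps(2))
    also have "\<dots> = ?c"
      using Comp_Id(1)[OF c c'] by simp
    finally show ?thesis ..
  qed
  also have "\<dots> = action (Suc m)"
    by (simp add: Suc)
  finally show ?case by simp
qed

text \<open>Here \<open>a\<close> and \<open>r\<close> count the factors before and after position
  \<open>i\<close>; this replaces all index subtractions.\<close>

lemma left_face_eq:
  assumes "n = a + Suc r" "i = Suc a"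
  shows "left_face C V \<Delta> tri \<epsilon> n i = action a \<otimes>\<^sub>m Id (pow r)"
proof -
  have "at_pos C V a (comult_pow C V \<Delta> a) (Suc a) = Id (pow a) \<otimes>\<^sub>m comult_pow C V \<Delta> a"
    by (subst at_pos_eq[where a = a and b = 0]) simp_all
  moreover have "perm_action C V (2 * Suc a - 1) (theta (Suc a)) = interleave a"
    by (simp add: interleave_def)
  ultimately show ?thesis
    using action_eq[of a] pow_odd[of a] obj_pow_double[of a] assms
    by (simp add: left_face_def shuffled_tri_def)
qed

lemma right_face_eq:
  assumes "n = a + Suc r" "i = Suc a"
  shows "right_face C V \<Delta> \<epsilon> n i = Id (pow a) \<otimes>\<^sub>m \<epsilon> \<otimes>\<^sub>m mor_pow C \<chi> r"
  using assms by (simp add: right_face_def)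

lemma degeneracy_eq:
  assumes "n = a + Suc r" "i = Suc a"
  shows "degeneracy C V \<Delta> n i = Id (pow a) \<otimes>\<^sub>m \<Delta> \<otimes>\<^sub>m Id (pow r)"
  using assms unfolding degeneracy_def by (intro at_pos_eq) simp_all

lemma pow_add_Suc: "pow (a + Suc r) = pow a \<otimes>\<^sub>o V \<otimes>\<^sub>o pow r"
  using obj_pow_add[of V a "Suc r"] by simp

lemma index_split:
  fixes i n :: nat
  assumes "1 \<le> i" "i \<le> n"
  obtains a r where "n = a + Suc r" "i = Suc a"
proof
  show "n = (i - 1) + Suc (n - i)" "i = Suc (i - 1)" using assms by simp_all
qed

lemma index_split2:
  fixes i j n :: nat
  assumes "1 \<le> i" "i < j" "j \<le> n"
  obtains a b r where "n = a + Suc (b + Suc r)" "i = Suc a" "j = Suc (a + Suc b)"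
proof
  show "n = (i - 1) + Suc ((j - i - 1) + Suc (n - j))" "i = Suc (i - 1)" 
    "j = Suc ((i - 1) + Suc (j - i - 1))" using assms by simp_all
qed

lemma left_face_in_Hom:
  assumes "1 \<le> i" "i \<le> n"
  shows "left_face C V \<Delta> tri \<epsilon> n i \<in> Hom (pow n) (pow (n - 1))"
  using assms
proof (rule index_split)
  fix a r assume *: "n = a + Suc r" "i = Suc a"
  then have "n - 1 = a + r" by simp
  with * show ?thesis
    unfolding left_face_eq[OF *] by (simp only: pow_add_Suc obj_pow_add V) (simp add: in_Hom_iff)
qed

lemma right_face_in_Hom:
  assumes "1 \<le> i" "i \<le> n"
  shows "right_face C V \<Delta> \<epsilon> n i \<in> Hom (pow n) (pow (n - 1))"
  using assms
proof (rule index_split)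
  fix a r assume *: "n = a + Suc r" "i = Suc a"
  then have "n - 1 = a + r" by simp
  with * show ?thesis
    unfolding right_face_eq[OF *] by (simp only: pow_add_Suc obj_pow_add V) (simp add: in_Hom_iff)
qed

lemma degeneracy_in_Hom:
  assumes "1 \<le> i" "i \<le> n"
  shows "degeneracy C V \<Delta> n i \<in> Hom (pow n) (pow (n + 1))"
  using assms
proof (rule index_split)
  fix a r assume *: "n = a + Suc r" "i = Suc a"
  then have "n + 1 = a + Suc (Suc r)" by simp
  with * show ?thesis
    unfolding degeneracy_eq[OF *] by (simp only: pow_add_Suc obj_pow.simps) (simp add: in_Hom_iff)
qed

section \<open>Identities for positions \<open>i < j\<close>, with \<open>a\<close>,
  \<open>b\<close>, \<open>r\<close> factors before, between and after them\<close>

context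
  fixes a b r n i j :: nat
  assumes n: "n = a + Suc (b + Suc r)" and i: "i = Suc a" and j: "j = Suc (a + Suc b)"
begin

lemma index_n: "n = (a + Suc b) + Suc r" and index_n1: "n - 1 = a + Suc (b + r)"
  and index_n1': "n - 1 = (a + b) + Suc r" and index_j1: "j - 1 = Suc (a + b)"
  and index_n_plus: "n + 1 = a + Suc (b + Suc (Suc r))" "n + 1 = (a + Suc (Suc b)) + Suc r"
    "j + 1 = Suc (a + Suc (Suc b))"
  by (simp_all add: n j)

lemmas left_eqs = left_face_eq[OF n i] left_face_eq[OF index_n j] left_face_eq[OF index_n1 i]
  left_face_eq[OF index_n1' index_j1]

lemmas right_eqs = right_face_eq[OF n i] right_face_eq[OF index_n j] right_face_eq[OF index_n1 i]
  right_face_eq[OF index_n1' index_j1]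

lemmas degeneracy_eqs = degeneracy_eq[OF n i] degeneracy_eq[OF index_n j] degeneracy_eq[OF index_n1 i]
  degeneracy_eq[OF index_n1' index_j1]

text \<open>Factor \<open>j\<close> acts on everything to its left. The face at \<open>i\<close> is
  equivariant for this action by \<open>action_self_distributive\<close>, hence
  \<open>action_twist\<close> with \<open>g = Id V\<close>.\<close>

lemma left_left: "left_face C V \<Delta> tri \<epsilon> (n - 1) i \<cdot> left_face C V \<Delta> tri \<epsilon> n j =
  left_face C V \<Delta> tri \<epsilon> (n - 1) (j - 1) \<cdot> left_face C V \<Delta> tri \<epsilon> n i"
proof -
  have "(action a \<otimes>\<^sub>m mor_pow C (Id V) b) \<cdot> action (Suc a + b) =
     action (a + b) \<cdot> (action a \<otimes>\<^sub>m mor_pow C (Id V) b \<otimes>\<^sub>m Id V)"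
    by (intro action_twist)
      (simp_all add: action_self_distributive obj_pow_Suc_right del: obj_pow.simps(2) action.simps)
  then have "((action a \<otimes>\<^sub>m Id (pow b)) \<otimes>\<^sub>m Id (pow r)) \<cdot> (action (a + Suc b) \<otimes>\<^sub>m Id (pow r)) =
     (action (a + b) \<otimes>\<^sub>m Id (pow r)) \<cdot> ((action a \<otimes>\<^sub>m Id (pow b) \<otimes>\<^sub>m Id V) \<otimes>\<^sub>m Id (pow r))"
    by (intro TensM_Comp_cong) (simp_all add: obj_pow_add pow_commute del: action.simps)
  then show ?thesis
    unfolding left_eqs pow_add_Suc obj_pow_add[OF V] by (simp del: action.simps)
qed

text \<open>The right face applies \<open>\<chi>\<close> to all factors after \<open>i\<close>,
  including the acting factor \<open>j\<close>: exactly \<open>action_twist\<close> with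
  \<open>g = \<chi>\<close>.\<close>

lemma right_left: "right_face C V \<Delta> \<epsilon> (n - 1) i \<cdot> left_face C V \<Delta> tri \<epsilon> n j =
  left_face C V \<Delta> tri \<epsilon> (n - 1) (j - 1) \<cdot> right_face C V \<Delta> \<epsilon> n i"
proof -
  let ?f = "Id (pow a) \<otimes>\<^sub>m \<epsilon>"
  have "(?f \<otimes>\<^sub>m mor_pow C \<chi> b) \<cdot> action (Suc a + b) =
     action (a + b) \<cdot> (?f \<otimes>\<^sub>m mor_pow C \<chi> b \<otimes>\<^sub>m \<chi>)"
    by (intro action_twist)
      (simp_all add: diag_character comult_chi chi_tri obj_pow_Suc_right del: obj_pow.simps(2))
  then have "((?f \<otimes>\<^sub>m mor_pow C \<chi> b) \<otimes>\<^sub>m mor_pow C \<chi> r) \<cdot> (action (a + Suc b) \<otimes>\<^sub>m Id (pow r)) =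
     (action (a + b) \<otimes>\<^sub>m Id (pow r)) \<cdot> ((?f \<otimes>\<^sub>m mor_pow C \<chi> b \<otimes>\<^sub>m \<chi>) \<otimes>\<^sub>m mor_pow C \<chi> r)"
    by (intro TensM_Comp_cong) (simp_all add: obj_pow_add pow_commute del: action.simps)
  then show ?thesis
    unfolding left_eqs right_eqs mor_pow_add[OF chi_simps(1)] mor_pow.simps(2) by (simp del: action.simps)
qed

text \<open>The left face involves only factors up to \<open>i\<close>, the right face only those
  from \<open>j\<close> on.\<close>

lemma left_right: "left_face C V \<Delta> tri \<epsilon> (n - 1) i \<cdot> right_face C V \<Delta> \<epsilon> n j =
  right_face C V \<Delta> \<epsilon> (n - 1) (j - 1) \<cdot> left_face C V \<Delta> tri \<epsilon> n i"
proof -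
  let ?q = "Id (pow b) \<otimes>\<^sub>m \<epsilon> \<otimes>\<^sub>m mor_pow C \<chi> r"
  have "(action a \<otimes>\<^sub>m Id (pow b \<otimes>\<^sub>o pow r)) \<cdot> (Id (pow a \<otimes>\<^sub>o V) \<otimes>\<^sub>m ?q) =
     (Id (pow a) \<otimes>\<^sub>m ?q) \<cdot> (action a \<otimes>\<^sub>m Id (pow b \<otimes>\<^sub>o V \<otimes>\<^sub>o pow r))"
    by (intro TensM_Comp_cong) simp_all
  then show ?thesis
    unfolding left_eqs right_eqs pow_add_Suc obj_pow_add[OF V] by simp
qed

text \<open>The sides differ only at factor \<open>j\<close>, which meets \<open>\<epsilon>\<close>
  either directly or after \<open>\<chi>\<close>; \<open>character_chi\<close> equates the two. All
  later factors receive \<open>\<chi>\<close> twice on both sides.\<close>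

lemma right_right: "right_face C V \<Delta> \<epsilon> (n - 1) i \<cdot> right_face C V \<Delta> \<epsilon> n j =
  right_face C V \<Delta> \<epsilon> (n - 1) (j - 1) \<cdot> right_face C V \<Delta> \<epsilon> n i"
proof -
  let ?x = "mor_pow C \<chi>"
  have "?x r \<cdot> (\<epsilon> \<otimes>\<^sub>m ?x r) = (\<epsilon> \<otimes>\<^sub>m ?x r) \<cdot> (\<chi> \<otimes>\<^sub>m ?x r)"
    using interchange[of \<epsilon> "Id \<I>" "?x r" "?x r"] interchange[of \<chi> \<epsilon> "?x r" "?x r"]
    by (simp add: character_chi)
  then have "((Id (pow a) \<otimes>\<^sub>m \<epsilon> \<otimes>\<^sub>m ?x b) \<otimes>\<^sub>m ?x r) \<cdot> (Id (pow a \<otimes>\<^sub>o V \<otimes>\<^sub>o pow b) \<otimes>\<^sub>m \<epsilon> \<otimes>\<^sub>m ?x r) =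
    (Id (pow a \<otimes>\<^sub>o pow b) \<otimes>\<^sub>m \<epsilon> \<otimes>\<^sub>m ?x r) \<cdot> ((Id (pow a) \<otimes>\<^sub>m \<epsilon> \<otimes>\<^sub>m ?x b) \<otimes>\<^sub>m \<chi> \<otimes>\<^sub>m ?x r)"
    by (intro TensM_Comp_cong) simp_all
  then show ?thesis
    unfolding right_eqs mor_pow_add[OF chi_simps(1)] mor_pow.simps(2) pow_add_Suc obj_pow_add[OF V] by simp
qed

lemma degeneracy_degeneracy:
  "degeneracy C V \<Delta> (n + 1) i \<cdot> degeneracy C V \<Delta> n j = degeneracy C V \<Delta> (n + 1) (j + 1) \<cdot> degeneracy C V \<Delta> n i"
proof -
  have "((Id (pow a) \<otimes>\<^sub>m \<Delta> \<otimes>\<^sub>m Id (pow b)) \<otimes>\<^sub>m Id (V \<otimes>\<^sub>o V \<otimes>\<^sub>o pow r)) \<cdot>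
      (Id (pow a \<otimes>\<^sub>o V \<otimes>\<^sub>o pow b) \<otimes>\<^sub>m \<Delta> \<otimes>\<^sub>m Id (pow r)) =
    (Id (pow a \<otimes>\<^sub>o V \<otimes>\<^sub>o V \<otimes>\<^sub>o pow b) \<otimes>\<^sub>m \<Delta> \<otimes>\<^sub>m Id (pow r)) \<cdot>
      ((Id (pow a) \<otimes>\<^sub>m \<Delta> \<otimes>\<^sub>m Id (pow b)) \<otimes>\<^sub>m Id (V \<otimes>\<^sub>o pow r))"
    by (intro TensM_Comp_cong) simp_all
  then show ?thesis
    unfolding degeneracy_eqs degeneracy_eq[OF index_n_plus(1) i] degeneracy_eq[OF index_n_plus(2,3)]
      pow_add_Suc obj_pow_add[OF V] obj_pow.simps by simp
qed

lemma left_degeneracy: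
  "left_face C V \<Delta> tri \<epsilon> (n + 1) i \<cdot> degeneracy C V \<Delta> n j = degeneracy C V \<Delta> (n - 1) (j - 1) \<cdot> left_face C V \<Delta> tri \<epsilon> n i"
proof -
  let ?q = "Id (pow b) \<otimes>\<^sub>m \<Delta> \<otimes>\<^sub>m Id (pow r)"
  have "(action a \<otimes>\<^sub>m Id (pow b \<otimes>\<^sub>o V \<otimes>\<^sub>o V \<otimes>\<^sub>o pow r)) \<cdot> (Id (pow a \<otimes>\<^sub>o V) \<otimes>\<^sub>m ?q) =
     (Id (pow a) \<otimes>\<^sub>m ?q) \<cdot> (action a \<otimes>\<^sub>m Id (pow b \<otimes>\<^sub>o V \<otimes>\<^sub>o pow r))"
    by (intro TensM_Comp_cong) simp_all
  then show ?thesis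
    unfolding left_eqs degeneracy_eqs left_face_eq[OF index_n_plus(1) i]
      pow_add_Suc obj_pow_add[OF V] obj_pow.simps by simp
qed

text \<open>The duplicated factor \<open>i\<close> is among those acted on by \<open>j\<close>, so
  this is equivariance of \<open>Id \<otimes> \<Delta>\<close> (\<open>diag_comult\<close>),
  extended by \<open>action_twist\<close>.\<close>

lemma left_degeneracy':
  "left_face C V \<Delta> tri \<epsilon> (n + 1) (j + 1) \<cdot> degeneracy C V \<Delta> n i = degeneracy C V \<Delta> (n - 1) i \<cdot> left_face C V \<Delta> tri \<epsilon> n j"
proof -
  let ?f = "Id (pow a) \<otimes>\<^sub>m \<Delta>"
  have "(?f \<otimes>\<^sub>m mor_pow C (Id V) b) \<cdot> action (Suc a + b) =
     action (Suc (Suc a) + b) \<cdot> (?f \<otimes>\<^sub>m mor_pow C (Id V) b \<otimes>\<^sub>m Id V)"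
    by (intro action_twist) (simp_all add: diag_comult obj_pow_Suc_right del: obj_pow.simps(2))
  then have "((?f \<otimes>\<^sub>m Id (pow b)) \<otimes>\<^sub>m Id (pow r)) \<cdot> (action (a + Suc b) \<otimes>\<^sub>m Id (pow r)) =
     (action (a + Suc (Suc b)) \<otimes>\<^sub>m Id (pow r)) \<cdot> ((?f \<otimes>\<^sub>m Id (pow b) \<otimes>\<^sub>m Id V) \<otimes>\<^sub>m Id (pow r))"
    by (intro TensM_Comp_cong) (simp_all add: obj_pow_add pow_commute del: action.simps)
  then show ?thesis
    unfolding left_eqs degeneracy_eqs left_face_eq[OF index_n_plus(2,3)]
      pow_add_Suc obj_pow_add[OF V] by (simp del: action.simps)
qed

end

text \<open>Equal positions are the case in which the two degeneracies interact, through
  coassociativity.\<close>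

lemma degeneracy_same:
  assumes "n = a + Suc r" "i = Suc a"
  shows "degeneracy C V \<Delta> (n + 1) i \<cdot> degeneracy C V \<Delta> n i = degeneracy C V \<Delta> (n + 1) (i + 1) \<cdot> degeneracy C V \<Delta> n i"
proof -
  have *: "n + 1 = a + Suc (Suc r)" "n + 1 = (a + Suc 0) + Suc r" "i + 1 = Suc (a + Suc 0)"
    using assms by simp_all
  have "(Id (pow a) \<otimes>\<^sub>m (\<Delta> \<otimes>\<^sub>m Id V) \<otimes>\<^sub>m Id (pow r)) \<cdot> (Id (pow a) \<otimes>\<^sub>m \<Delta> \<otimes>\<^sub>m Id (pow r)) =
    (Id (pow a) \<otimes>\<^sub>m (Id V \<otimes>\<^sub>m \<Delta>) \<otimes>\<^sub>m Id (pow r)) \<cdot> (Id (pow a) \<otimes>\<^sub>m \<Delta> \<otimes>\<^sub>m Id (pow r))"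
    by (intro TensM_Comp_cong) (simp_all add: coassoc)
  then show ?thesis
    unfolding degeneracy_eq[OF assms] degeneracy_eq[OF *(1) assms(2)] degeneracy_eq[OF *(2,3)]
      pow_add_Suc obj_pow.simps by simp
qed

section \<open>Assembly of the simplicial structures\<close>

lemma pre_bisimplicial_faces:
  "pre_bisimplicial C (obj_pow C V) (left_face C V \<Delta> tri \<epsilon>) (right_face C V \<Delta> \<epsilon>)"
  unfolding pre_bisimplicial_def presimplicial_def
  by (intro conjI allI impI; (elim conjE)?)
    (assumption | rule V obj_pow_in_Obj left_face_in_Hom right_face_in_Hom
      | erule (2) index_split2, rule left_left left_right right_left right_right, assumption+)+

lemma very_weakly_simplicial_left:
  "very_weakly_simplicial C (obj_pow C V) (left_face C V \<Delta> tri \<epsilon>) (degeneracy C V \<Delta>)"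
  unfolding very_weakly_simplicial_def
proof (intro conjI allI impI; (elim conjE)?)
  show "presimplicial C (obj_pow C V) (left_face C V \<Delta> tri \<epsilon>)"
    using pre_bisimplicial_faces by (simp add: pre_bisimplicial_def)
next
  fix n i :: nat assume "1 \<le> i" "i \<le> n"
  then show "degeneracy C V \<Delta> n i \<in> Hom (pow n) (pow (n + 1))" by (rule degeneracy_in_Hom)
next
  fix n i j :: nat assume *: "1 \<le> i" "i \<le> j" "j \<le> n"
  show "degeneracy C V \<Delta> (n + 1) i \<cdot> degeneracy C V \<Delta> n j =
    degeneracy C V \<Delta> (n + 1) (j + 1) \<cdot> degeneracy C V \<Delta> n i"
  proof (cases "i = j")
    case True
    with * show ?thesis by (metis degeneracy_same index_split)
  next
    case False
    with * show ?thesis by (metis degeneracy_degeneracy index_split2 le_neq_implies_less)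
  qed
next
  fix n i j :: nat assume *: "1 \<le> i" "i < j" "j \<le> n"
  then show "left_face C V \<Delta> tri \<epsilon> (n + 1) i \<cdot> degeneracy C V \<Delta> n j =
    degeneracy C V \<Delta> (n - 1) (j - 1) \<cdot> left_face C V \<Delta> tri \<epsilon> n i"
    by (rule index_split2) (rule left_degeneracy)
next
  fix n i j :: nat assume *: "1 \<le> j" "j + 1 < i" "i \<le> n + 1"
  \<comment> \<open>The face index is lowered by one: \<open>left_degeneracy'\<close> is stated for
    the pair \<open>j < i - 1\<close>.\<close>
  then have "1 \<le> j" "j < i - 1" "i - 1 \<le> n" by auto
  then have "left_face C V \<Delta> tri \<epsilon> (n + 1) (i - 1 + 1) \<cdot> degeneracy C V \<Delta> n j =
    degeneracy C V \<Delta> (n - 1) j \<cdot> left_face C V \<Delta> tri \<epsilon> n (i - 1)"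
    by (rule index_split2) (rule left_degeneracy')
  then show "left_face C V \<Delta> tri \<epsilon> (n + 1) i \<cdot> degeneracy C V \<Delta> n j =
    degeneracy C V \<Delta> (n - 1) j \<cdot> left_face C V \<Delta> tri \<epsilon> n (i - 1)"
    using * by simp
qed

text \<open>With three copies of the last factor, the left side is
  \<open>\<rho> (x \<otimes> y'') \<otimes> tri (y' \<otimes> y''')\<close>. Cocommutativity
  exchanges \<open>y'\<close> and \<open>y''\<close>, and then
  \<open>tri \<cdot> \<Delta> = Id V\<close> contracts the last two.\<close>

lemma spindle_diag_comult:
  assumes "spindle C V \<Delta> tri"
    and [simp]: "X \<in> Obj C" "\<rho> \<in> Arr C" "Dom C \<rho> = X \<otimes>\<^sub>o V" "Cod C \<rho> = X"
  shows "diag X \<rho> \<cdot> (Id X \<otimes>\<^sub>m \<Delta>) = (\<rho> \<otimes>\<^sub>m Id V) \<cdot> (Id X \<otimes>\<^sub>m \<Delta>)"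
proof -
  have c: "(\<c> V V \<otimes>\<^sub>m Id V) \<cdot> (Id V \<otimes>\<^sub>m \<Delta>) \<cdot> \<Delta> = (Id V \<otimes>\<^sub>m \<Delta>) \<cdot> \<Delta>" and t: "tri \<cdot> \<Delta> = Id V"
  proof -
    have "at_pos C V 1 (\<c> V V) 1 \<cdot> comult_pow C V \<Delta> 2 = comult_pow C V \<Delta> 2" "tri \<cdot> \<Delta> = Id V"
      using assms unfolding spindle_def by blast+
    then show "(\<c> V V \<otimes>\<^sub>m Id V) \<cdot> (Id V \<otimes>\<^sub>m \<Delta>) \<cdot> \<Delta> = (Id V \<otimes>\<^sub>m \<Delta>) \<cdot> \<Delta>" "tri \<cdot> \<Delta> = Id V"
      by (simp_all add: at_pos_def numeral_2_eq_2 coassoc)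
  qed
  have "diag X \<rho> \<cdot> (Id X \<otimes>\<^sub>m \<Delta>) = (\<rho> \<otimes>\<^sub>m tri) \<cdot> (Id X \<otimes>\<^sub>m ((\<c> V V \<otimes>\<^sub>m Id V) \<cdot> (Id V \<otimes>\<^sub>m \<Delta>) \<cdot> \<Delta>))"
    by (simp add: conv_def expand)
  also have "\<dots> = ((\<rho> \<otimes>\<^sub>m tri) \<cdot> (Id (X \<otimes>\<^sub>o V) \<otimes>\<^sub>m \<Delta>)) \<cdot> (Id X \<otimes>\<^sub>m \<Delta>)"
    by (simp only: c) (simp add: expand)
  also have "(\<rho> \<otimes>\<^sub>m tri) \<cdot> (Id (X \<otimes>\<^sub>o V) \<otimes>\<^sub>m \<Delta>) = \<rho> \<otimes>\<^sub>m Id V"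
    by (simp add: interchange t del: Id_TensO)
  finally show ?thesis .
qed

lemma weakly_simplicial_left:
  assumes "spindle C V \<Delta> tri"
  shows "weakly_simplicial C (obj_pow C V) (left_face C V \<Delta> tri \<epsilon>) (degeneracy C V \<Delta>)"
  unfolding weakly_simplicial_def
proof (intro conjI allI impI; (elim conjE)?)
  fix n i :: nat assume "1 \<le> i" "i \<le> n"
  then obtain a r where *: "n = a + Suc r" "i = Suc a" by (rule index_split)
  then have **: "n + 1 = a + Suc (Suc r)" "n + 1 = Suc a + Suc r" "i + 1 = Suc (Suc a)" by simp_all
  \<comment> \<open>In face \<open>i\<close> the first copy acts on \<open>a\<close> factors and the
    second survives; in face \<open>i + 1\<close> the second copy acts on these and on the first
    copy. \<open>spindle_diag_comult\<close> compares the two.\<close>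
  have "((action a \<otimes>\<^sub>m Id V) \<otimes>\<^sub>m Id (pow r)) \<cdot> ((Id (pow a) \<otimes>\<^sub>m \<Delta>) \<otimes>\<^sub>m Id (pow r)) =
    (action (Suc a) \<otimes>\<^sub>m Id (pow r)) \<cdot> ((Id (pow a) \<otimes>\<^sub>m \<Delta>) \<otimes>\<^sub>m Id (pow r))"
    by (intro TensM_Comp_cong)
      (simp_all add: spindle_diag_comult[OF assms] obj_pow_Suc_right del: obj_pow.simps(2))
  then show "left_face C V \<Delta> tri \<epsilon> (n + 1) i \<cdot> degeneracy C V \<Delta> n i =
    left_face C V \<Delta> tri \<epsilon> (n + 1) (i + 1) \<cdot> degeneracy C V \<Delta> n i"
    unfolding degeneracy_eq[OF *] left_face_eq[OF **(1) *(2)] left_face_eq[OF **(2,3)] obj_pow.simps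
    by (simp del: action.simps)
qed (rule very_weakly_simplicial_left)

end

theorem theorem10:
  fixes C :: "('o, 'm, 'z) symmetric_preadditive_category_scheme"
    and V :: 'o and \<Delta> tri \<epsilon> :: 'm
  assumes "symmetric_preadditive_category C"
    and "shelf C V \<Delta> tri"
    and "shelf_character C V \<Delta> tri \<epsilon>"
  shows "pre_bisimplicial C (obj_pow C V) (left_face C V \<Delta> tri \<epsilon>) (right_face C V \<Delta> \<epsilon>) \<and>
    very_weakly_simplicial C (obj_pow C V) (left_face C V \<Delta> tri \<epsilon>) (degeneracy C V \<Delta>) \<and>
    (spindle C V \<Delta> tri \<longrightarrow>
      weakly_simplicial C (obj_pow C V) (left_face C V \<Delta> tri \<epsilon>) (degeneracy C V \<Delta>))"
proof -
  interpret symmetric_preadditive_category C by (rule assms(1))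
  interpret shelf_with_character C V \<Delta> tri \<epsilon>
    using assms(2,3) by unfold_locales (simp_all add: shelf_def)
  show ?thesis
    using pre_bisimplicial_faces very_weakly_simplicial_left weakly_simplicial_left by blast
qed

end
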